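(* Let $S$ be a finite poset which can be decomposed as a union $S=S_1\cup S_2$ of two unitarily one-parameter posets $S_1$, $S_2$ (elements of $S_1$ are allowed to be comparable with elements of $S_2$). Let $\alpha=(\alpha_g)_{g\in S}$ be a character on $S$ with $0<\alpha_g<1$ for all $g\in S$ and $\sum_{g\in S}\alpha_g>1$. Then any irreducible orthoscalar representation of $S$ with character $\alpha$ is finite-dimensional.
   Context: A finite poset $T$ is called unitarily one-parameter if it can be written as $T=T_1\cup\dots\cup T_m$ (disjoint), where the $T_i$ are totally ordered as blocks (for $i<j$, every element of $T_i$ is strictly less than every element of $T_j$), exactly one block $T_k$ consists of two incomparable elements, and every other block consists of a single element. The subsets $S_1,S_2$ of $S$ carry the order induced from $S$. A (Hilbert) representation of a finite poset $S$ on a complex Hilbert space $H\neq\{0\}$ is a family of orthogonal projections $P_g$, $g\in S$, in $H$ such that $P_gP_h=P_g$ whenever $g<h$ (equivalently, the ranges satisfy $\operatorname{ran}P_g\subset \operatorname{ran}P_h$ for $g<h$). It is irreducible if the only closed subspaces of $H$ invariant under all $P_g$, $g\in S$, are $\{0\}$ and $H$. It is finite-dimensional if $\dim H<\infty$. A character on $S$ is a function $S\ni g\mapsto\alpha_g>0$. A representation is orthoscalar with character $\alpha=(\alpha_g)_{g\in S}$ if $\sum_{g\in S}\alpha_gP_g=I$. *)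

theory Defs
  imports "HOL-Analysis.Analysis"
begin

section \<open>Complex Hilbert spaces\<close>

text \<open>
  The norm, metric and topology are those of the underlying real inner product space, whose
  inner product is the real part of the complex one.  The complex inner product is linear in its
  first argument.  Its positive definiteness is inherited from the real one, see the lemma
  \<open>cinner_self\<close> below.
\<close>

class complex_inner = real_inner +
  fixes scaleC :: "complex \<Rightarrow> 'a \<Rightarrow> 'a" (infixr "*\<^sub>C" 75)
    and cinner :: "'a \<Rightarrow> 'a \<Rightarrow> complex"
  assumes scaleC_add_right: "c *\<^sub>C (x + y) = c *\<^sub>C x + c *\<^sub>C y"
    and scaleC_add_left: "(c + d) *\<^sub>C x = c *\<^sub>C x + d *\<^sub>C x"
    and scaleC_scaleC: "c *\<^sub>C d *\<^sub>C x = (c * d) *\<^sub>C x"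
    and scaleC_complex_of_real: "complex_of_real r *\<^sub>C x = r *\<^sub>R x"
    and cinner_commute: "cinner x y = cnj (cinner y x)"
    and cinner_add_left: "cinner (x + y) z = cinner x z + cinner y z"
    and cinner_scaleC_left: "cinner (c *\<^sub>C x) y = c * cinner x y"
    and Re_cinner: "Re (cinner x y) = inner x y"

class chilbert_space = complex_inner + complete_space

lemma vector_space_scaleC: "vector_space (scaleC :: complex \<Rightarrow> 'a::complex_inner \<Rightarrow> 'a)"
proof
  show "1 *\<^sub>C x = x" for x :: 'a
    using scaleC_complex_of_real [of 1 x] by simp
qed (simp_all add: scaleC_add_right scaleC_add_left scaleC_scaleC)

global_interpretation complex_vector:
  vector_space "scaleC :: complex \<Rightarrow> 'a::complex_inner \<Rightarrow> 'a"
  by (rule vector_space_scaleC)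

lemma cinner_self: "cinner x x = complex_of_real ((norm x)\<^sup>2)"
proof (rule complex_eqI)
  show "Re (cinner x x) = Re (complex_of_real ((norm x)\<^sup>2))"
    by (simp add: Re_cinner power2_norm_eq_inner)
  have "Im (cinner x x) = - Im (cinner x x)"
    by (subst cinner_commute) simp
  then show "Im (cinner x x) = Im (complex_of_real ((norm x)\<^sup>2))"
    by simp
qed

instantiation complex :: chilbert_space
begin

definition scaleC_complex :: "complex \<Rightarrow> complex \<Rightarrow> complex"
  where "scaleC_complex c x = c * x"

definition cinner_complex :: "complex \<Rightarrow> complex \<Rightarrow> complex"
  where "cinner_complex x y = x * cnj y"

instance
  by standard
    (simp_all add: scaleC_complex_def cinner_complex_def inner_complex_def algebra_simps
      scaleR_conv_of_real)

end

definition orthogonal_projection :: "('h::complex_inner \<Rightarrow> 'h) \<Rightarrow> bool"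
  where "orthogonal_projection P \<longleftrightarrow>
    bounded_linear P \<and> (\<forall>c x. P (c *\<^sub>C x) = c *\<^sub>C P x) \<and>
    P \<circ> P = P \<and> (\<forall>x y. cinner (P x) y = cinner x (P y))"

section \<open>Posets and their representations\<close>

definition unitarily_one_parameter :: "'a::order set \<Rightarrow> bool"
  where "unitarily_one_parameter T \<longleftrightarrow>
    (\<exists>m k. \<exists>B :: nat \<Rightarrow> 'a set.
      k \<in> {1..m} \<and>
      T = (\<Union>i\<in>{1..m}. B i) \<and>
      disjoint_family_on B {1..m} \<and>
      (\<forall>i\<in>{1..m}. \<forall>j\<in>{1..m}. i < j \<longrightarrow> (\<forall>x\<in>B i. \<forall>y\<in>B j. x < y)) \<and>
      (\<exists>x y. B k = {x, y} \<and> \<not> x \<le> y \<and> \<not> y \<le> x) \<and>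
      (\<forall>i\<in>{1..m} - {k}. \<exists>x. B i = {x}))"

text \<open>Only the values of \<open>P\<close> on \<open>S\<close> matter.\<close>

definition hilbert_representation :: "'a::order set \<Rightarrow> ('a \<Rightarrow> 'h::chilbert_space \<Rightarrow> 'h) \<Rightarrow> bool"
  where "hilbert_representation S P \<longleftrightarrow>
    (UNIV :: 'h set) \<noteq> {0} \<and>
    (\<forall>g\<in>S. orthogonal_projection (P g)) \<and>
    (\<forall>g\<in>S. \<forall>h\<in>S. g < h \<longrightarrow> P g \<circ> P h = P g)"

definition irreducible_family :: "'a set \<Rightarrow> ('a \<Rightarrow> 'h::chilbert_space \<Rightarrow> 'h) \<Rightarrow> bool"
  where "irreducible_family S P \<longleftrightarrow>
    (\<forall>M. complex_vector.subspace M \<and> closed M \<and> (\<forall>g\<in>S. P g ` M \<subseteq> M) \<longrightarrow> M = {0} \<or> M = UNIV)"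

definition orthoscalar :: "'a set \<Rightarrow> ('a \<Rightarrow> real) \<Rightarrow> ('a \<Rightarrow> 'h::chilbert_space \<Rightarrow> 'h) \<Rightarrow> bool"
  where "orthoscalar S \<alpha> P \<longleftrightarrow> (\<forall>x. (\<Sum>g\<in>S. \<alpha> g *\<^sub>R P g x) = x)"

end

theory Submission
  imports Defs "HOL-Computational_Algebra.Fundamental_Theorem_Algebra"
begin

text \<open>
  Let \<open>w\<close> be the character, halved at the elements that lie in both \<open>S\<^sub>1\<close> and \<open>S\<^sub>2\<close>, and let \<open>A\<close> and
  \<open>B\<close> be the sums of \<open>w g *\<^sub>R P g\<close> over \<open>S\<^sub>1\<close> and over \<open>S\<^sub>2\<close>.  Orthoscalarity says that \<open>A\<close> and \<open>B\<close> add
  up to the identity, so \<open>0 \<le> A \<le> 1\<close>, and everything known about \<open>B\<close> is a statement about \<open>A\<close>.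

  In a unitarily one-parameter poset all elements except the incomparable pair \<open>p\<close>, \<open>q\<close> are
  comparable with everything, and their projections act on each eigenspace of \<open>A\<close> as \<open>0\<close> or \<open>1\<close>
  (\<open>eigenvector_chain\<close>).  For the pair, two projections in general position decompose into blocks
  of size two, and the two eigenvalues of \<open>w p *\<^sub>R P p + w q *\<^sub>R P q\<close> in each block have the sum
  \<open>w p + w q\<close>.  Hence there is a center \<open>s\<close> such that \<open>(A - s)\<^sup>2\<close> commutes with all \<open>P g\<close>, \<open>g \<in> S\<^sub>1\<close>
  (\<open>V_square_commute\<close>), and \<open>P p\<close> maps the eigenspace of \<open>A\<close> at \<open>l\<close> into the sum of the eigenspaces
  at \<open>l\<close> and at the reflected point \<open>2 * s - l\<close> (\<open>eigenvector_reflection\<close>).  The second poset gives a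
  second center \<open>s'\<close> for the same operator \<open>A\<close>.  A continuous function \<open>c\<close> which is symmetric about both
  centers yields an operator \<open>c(A)\<close> that commutes with the whole representation, so it is a scalar by
  Schur's lemma (\<open>schur\<close>).

  If \<open>s \<noteq> s'\<close>, take \<open>c(t) = cos (pi * (t - s) / (s' - s))\<close>.  Its level sets in the unit interval are finite,
  so \<open>A\<close> has an eigenvalue and only finitely many of them (\<open>two_centers_finite_eigenvalues\<close>).  Applying
  the off-diagonal parts of the two projections alternately to an eigenvector moves the eigenvalue by
  \<open>2 * (s' - s)\<close> in every second step, so the resulting path of eigenvectors is finite (\<open>reflection_ray\<close>).  If \<open>s = s'\<close>, then
  \<open>(A - s)\<^sup>2\<close> itself is a scalar.  The parts \<open>K\<close>, \<open>K'\<close> of the two projections that exchange the at most two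
  eigenspaces of \<open>A\<close> have scalar squares, \<open>K K' + K' K\<close> is a scalar by Schur's lemma, and an eigenvector
  \<open>x\<close> together with \<open>K x\<close>, \<open>K' x\<close>, \<open>K K' x\<close> is closed under both (\<open>equal_centers_finite\<close>).

  For an eigenvector \<open>x\<close> of \<open>A\<close> every \<open>P g x\<close> is a combination of \<open>x\<close> and the images of \<open>x\<close> under the two
  distinguished projections (\<open>eigenvector_span\<close>).  So in both cases the finite system of eigenvectors
  spans an invariant subspace; it is closed and nonzero, hence it is the whole space.

  Schur's lemma and the level set argument use a continuous functional calculus for operators
  \<open>T\<close> with \<open>0 \<le> T \<le> 1\<close>.  It rests on a single fact: a real polynomial which is nonnegative on the
  unit interval takes \<open>T\<close> to a positive operator (\<open>poly_operator_nonneg\<close>).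
\<close>

section \<open>Symmetric and positive operators\<close>

definition symmetric_operator :: "('h::real_inner \<Rightarrow> 'h) \<Rightarrow> bool"
  where "symmetric_operator T \<longleftrightarrow>
    bounded_linear T \<and> (\<forall>x y. inner (T x) y = inner x (T y))"

definition positive_operator :: "('h::real_inner \<Rightarrow> 'h) \<Rightarrow> bool"
  where "positive_operator T \<longleftrightarrow> symmetric_operator T \<and> (\<forall>x. 0 \<le> inner (T x) x)"

lemma symmetric_operator_linear: "symmetric_operator T \<Longrightarrow> bounded_linear T"
  by (simp add: symmetric_operator_def)

lemma symmetric_operator_inner: "symmetric_operator T \<Longrightarrow> inner (T x) y = inner x (T y)"
  by (simp add: symmetric_operator_def)

lemma symmetric_operator_id: "symmetric_operator (\<lambda>x. x)"
  by (simp add: symmetric_operator_def bounded_linear_ident)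

lemma symmetric_operator_add:
  "symmetric_operator T \<Longrightarrow> symmetric_operator U \<Longrightarrow> symmetric_operator (\<lambda>x. T x + U x)"
  by (simp add: symmetric_operator_def bounded_linear_add inner_add_left inner_add_right)

lemma symmetric_operator_diff:
  "symmetric_operator T \<Longrightarrow> symmetric_operator U \<Longrightarrow> symmetric_operator (\<lambda>x. T x - U x)"
  by (simp add: symmetric_operator_def bounded_linear_sub inner_diff_left inner_diff_right)

lemma symmetric_operator_scaleR:
  "symmetric_operator T \<Longrightarrow> symmetric_operator (\<lambda>x. c *\<^sub>R T x)"
  by (simp add: symmetric_operator_def bounded_linear_const_scaleR)

lemma symmetric_operator_comp:
  assumes "symmetric_operator T" "symmetric_operator U" "\<And>x. T (U x) = U (T x)"
  shows "symmetric_operator (\<lambda>x. T (U x))"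
  using assms bounded_linear_compose[of T U] by (simp add: symmetric_operator_def)

lemma positive_operator_symmetric: "positive_operator T \<Longrightarrow> symmetric_operator T"
  by (simp add: positive_operator_def)

lemma positive_operator_inner: "positive_operator T \<Longrightarrow> 0 \<le> inner (T x) x"
  by (simp add: positive_operator_def)

lemma positive_operator_add:
  "positive_operator T \<Longrightarrow> positive_operator U \<Longrightarrow> positive_operator (\<lambda>x. T x + U x)"
  by (simp add: positive_operator_def symmetric_operator_add inner_add_left)

lemma positive_operator_scaleR:
  "positive_operator T \<Longrightarrow> 0 \<le> c \<Longrightarrow> positive_operator (\<lambda>x. c *\<^sub>R T x)"
  by (simp add: positive_operator_def symmetric_operator_scaleR)

lemma positive_operator_id: "positive_operator (\<lambda>x. x)"
  by (simp add: positive_operator_def symmetric_operator_id)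

lemma positive_operator_square:
  "symmetric_operator T \<Longrightarrow> positive_operator (\<lambda>x. T (T x))"
  by (simp add: positive_operator_def symmetric_operator_comp symmetric_operator_inner[of T "T _"])

text \<open>
  Riesz's iteration \<open>T\<^sub>0 = T\<close>, \<open>T\<^sub>n\<^sub>+\<^sub>1 = T\<^sub>n - T\<^sub>n\<^sup>2\<close>.  Summing the recursion writes \<open>T\<close> as
  the sum of the squares of the iterates up to a remainder, which replaces a square root of \<open>T\<close>.
\<close>

primrec riesz_iterate :: "('h::real_inner \<Rightarrow> 'h) \<Rightarrow> nat \<Rightarrow> 'h \<Rightarrow> 'h" where
  "riesz_iterate T 0 = T"
| "riesz_iterate T (Suc n) = (\<lambda>x. riesz_iterate T n x - riesz_iterate T n (riesz_iterate T n x))"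

text \<open>
  With \<open>U = T\<^sub>n\<close> the identity \<open>U - U\<^sup>2 = (1 - U) U (1 - U) + U (1 - U) U\<close> shows that the bounds
  \<open>0 \<le> U \<le> 1\<close> pass to the next iterate.
\<close>

lemma riesz_iterate_bounds:
  assumes "positive_operator T" "\<And>x. inner (T x) x \<le> inner x x"
  shows "positive_operator (riesz_iterate T n) \<and> (\<forall>x. inner (riesz_iterate T n x) x \<le> inner x x)"
proof (induction n)
  case 0
  then show ?case using assms by simp
next
  case (Suc n)
  define U where "U = riesz_iterate T n"
  have pos: "positive_operator U" and le: "\<And>x. inner (U x) x \<le> inner x x"
    using Suc by (auto simp: U_def)
  have sym: "symmetric_operator U" by (rule positive_operator_symmetric[OF pos])
  interpret U: bounded_linear U by (rule symmetric_operator_linear[OF sym])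
  have "0 \<le> inner (U x - U (U x)) x" for x
  proof -
    have "inner (U x - U (U x)) x
        = inner (U (x - U x)) (x - U x) + (inner (U x) (U x) - inner (U (U x)) (U x))"
      by (simp add: U.diff inner_diff_left inner_diff_right symmetric_operator_inner[OF sym])
    moreover have "0 \<le> inner (U (x - U x)) (x - U x)" by (rule positive_operator_inner[OF pos])
    ultimately show ?thesis using le[of "U x"] by linarith
  qed
  moreover have "inner (U x - U (U x)) x \<le> inner x x" for x
    using le[of x] inner_ge_zero[of "U x"]
    by (simp add: inner_diff_left symmetric_operator_inner[OF sym])
  moreover have "symmetric_operator (\<lambda>x. U x - U (U x))"
    by (rule symmetric_operator_diff[OF sym symmetric_operator_comp[OF sym sym refl]])
  ultimately show ?case by (simp add: positive_operator_def U_def)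
qed

lemma riesz_iterate_commute:
  assumes "bounded_linear B" "\<And>x. B (T x) = T (B x)"
  shows "B (riesz_iterate T n x) = riesz_iterate T n (B x)"
proof (induction n arbitrary: x)
  case (Suc n)
  then show ?case by (simp add: linear_diff bounded_linear.linear[OF assms(1)])
qed (simp add: assms)

lemma riesz_iterate_telescope:
  assumes T: "positive_operator T" "\<And>x. inner (T x) x \<le> inner x x"
    and B: "bounded_linear B" "\<And>x. B (T x) = T (B x)"
  shows "inner (B (T x)) x
    = (\<Sum>k<n. inner (B (riesz_iterate T k x)) (riesz_iterate T k x)) + inner (B (riesz_iterate T n x)) x"
proof (induction n)
  case (Suc n)
  have "symmetric_operator (riesz_iterate T n)"
    using riesz_iterate_bounds[OF T] positive_operator_symmetric by blast
  then have "inner (B (riesz_iterate T n (riesz_iterate T n x))) x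
      = inner (B (riesz_iterate T n x)) (riesz_iterate T n x)"
    by (simp add: riesz_iterate_commute[of B T, OF B] symmetric_operator_inner)
  then show ?case
    using Suc by (simp add: linear_diff bounded_linear.linear[OF B(1)] inner_diff_left)
qed simp

text \<open>
  If \<open>B\<close> commutes with \<open>T\<close>, it commutes with all iterates, so the quadratic form of \<open>B T\<close> at \<open>x\<close> is the
  sum of the values of the form of \<open>B\<close> at the vectors \<open>T\<^sub>k x\<close>, up to a remainder.  The case where \<open>B\<close> is the
  identity bounds the sum of the squared norms of \<open>T\<^sub>k x\<close>; so \<open>T\<^sub>n x\<close> tends to zero and the remainder vanishes.
\<close>

lemma positive_operator_comp_contraction:
  assumes T: "positive_operator T" "\<And>x. inner (T x) x \<le> inner x x"
    and B: "positive_operator B" and comm: "\<And>x. B (T x) = T (B x)"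
  shows "0 \<le> inner (B (T x)) x"
proof -
  let ?a = "\<lambda>n. riesz_iterate T n x"
  have lin: "bounded_linear B"
    using B positive_operator_symmetric symmetric_operator_linear by blast
  have "(\<Sum>k<n. (norm (?a k))\<^sup>2) \<le> inner (T x) x" for n
    using riesz_iterate_telescope[OF T bounded_linear_ident, of x n] riesz_iterate_bounds[OF T, of n]
    by (simp add: positive_operator_def power2_norm_eq_inner)
  then have "summable (\<lambda>k. (norm (?a k))\<^sup>2)"
    by (intro summableI_nonneg_bounded) auto
  then have "(\<lambda>k. (norm (?a k))\<^sup>2) \<longlonglongrightarrow> 0" by (rule summable_LIMSEQ_zero)
  then have "?a \<longlonglongrightarrow> 0"
    using tendsto_real_sqrt[of "\<lambda>n. (norm (?a n))\<^sup>2" 0 sequentially] by (simp add: tendsto_norm_zero_iff)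
  then have "(\<lambda>n. inner (B (?a n)) x) \<longlonglongrightarrow> inner (B 0) x"
    by (intro tendsto_inner tendsto_const bounded_linear.tendsto[OF lin])
  then have lim: "(\<lambda>n. inner (B (?a n)) x) \<longlonglongrightarrow> 0"
    by (simp add: linear_0 bounded_linear.linear[OF lin])
  have "inner (B (?a n)) x \<le> inner (B (T x)) x" for n
    using riesz_iterate_telescope[OF T lin comm, of x n] positive_operator_inner[OF B]
    by (simp add: sum_nonneg)
  then show ?thesis using LIMSEQ_le_const2[OF lim] by blast
qed

text \<open>
  Scaling \<open>T\<close> by its norm reduces the claim to the case \<open>T \<le> 1\<close>.
\<close>

lemma positive_operator_comp:
  assumes T: "positive_operator T" and B: "positive_operator B"
    and comm: "\<And>x. B (T x) = T (B x)"
  shows "positive_operator (\<lambda>x. B (T x))"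
proof -
  have sT: "symmetric_operator T" and sB: "symmetric_operator B"
    using T B positive_operator_symmetric by auto
  have lin: "bounded_linear B" using sB symmetric_operator_linear by blast
  obtain K where K: "0 < K" "\<And>x. norm (T x) \<le> norm x * K"
    using bounded_linear.pos_bounded[OF symmetric_operator_linear[OF sT]] by blast
  define T' where "T' = (\<lambda>x. (1/K) *\<^sub>R T x)"
  have "positive_operator T'"
    unfolding T'_def using K(1) by (intro positive_operator_scaleR T) simp
  moreover have "inner (T' x) x \<le> inner x x" for x
  proof -
    have "inner (T x) x \<le> norm (T x) * norm x" by (rule norm_cauchy_schwarz)
    also have "\<dots> \<le> (norm x * K) * norm x" by (intro mult_right_mono K) simp
    finally show ?thesis
      using K(1) by (simp add: T'_def field_simps power2_norm_eq_inner[symmetric] power2_eq_square)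
  qed
  moreover have "B (T' x) = T' (B x)" for x
    by (simp add: T'_def linear_scale bounded_linear.linear[OF lin] comm)
  ultimately have "0 \<le> inner (B (T' x)) x" for x
    using positive_operator_comp_contraction[of T' B] B by blast
  then have "0 \<le> (1/K) * inner (B (T x)) x" for x
    by (simp add: T'_def linear_scale bounded_linear.linear[OF lin])
  then have "0 \<le> inner (B (T x)) x" for x using K(1) by (simp add: zero_le_divide_iff)
  then show ?thesis
    using symmetric_operator_comp[OF sB sT comm] by (simp add: positive_operator_def)
qed

section \<open>Polynomials in an operator\<close>

definition poly_operator :: "real poly \<Rightarrow> ('h::real_vector \<Rightarrow> 'h) \<Rightarrow> 'h \<Rightarrow> 'h"
  where "poly_operator p T = fold_coeffs (\<lambda>a f x. a *\<^sub>R x + T (f x)) p (\<lambda>x. 0)"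

lemma poly_operator_0 [simp]: "poly_operator 0 T x = 0"
  by (simp add: poly_operator_def)

lemma poly_operator_pCons:
  assumes "linear T"
  shows "poly_operator (pCons a p) T x = a *\<^sub>R x + T (poly_operator p T x)"
  using assms by (cases "p = 0 \<and> a = 0") (auto simp: poly_operator_def linear_0)

lemma poly_operator_add:
  assumes "linear T"
  shows "poly_operator (p + q) T x = poly_operator p T x + poly_operator q T x"
  by (induction p q rule: poly_induct2)
    (simp_all add: poly_operator_pCons[OF assms] linear_add[OF assms] algebra_simps)

lemma poly_operator_smult:
  assumes "linear T"
  shows "poly_operator (smult c p) T x = c *\<^sub>R poly_operator p T x"
  by (induction p)
    (simp_all add: poly_operator_pCons[OF assms] linear_scale[OF assms] algebra_simps)

lemma poly_operator_diff:
  assumes "linear T"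
  shows "poly_operator (p - q) T x = poly_operator p T x - poly_operator q T x"
  using poly_operator_add[OF assms, of p "smult (-1) q" x] poly_operator_smult[OF assms, of "-1" q x]
  by simp

lemma bounded_linear_poly_operator:
  assumes "bounded_linear T"
  shows "bounded_linear (poly_operator p T)"
proof (induction p)
  case 0
  then show ?case by (simp add: poly_operator_def)
next
  case (pCons a p)
  have "poly_operator (pCons a p) T = (\<lambda>x. a *\<^sub>R x + T (poly_operator p T x))"
    by (rule ext) (rule poly_operator_pCons[OF bounded_linear.linear[OF assms]])
  then show ?case
    by (simp add: bounded_linear_add bounded_linear_scaleR_right bounded_linear_compose[OF assms pCons.IH])
qed

lemma poly_operator_mult:
  assumes "linear T"
  shows "poly_operator (p * q) T x = poly_operator p T (poly_operator q T x)"
  by (induction p)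
    (simp_all add: poly_operator_pCons[OF assms] poly_operator_add[OF assms] poly_operator_smult[OF assms])

lemma poly_operator_commute:
  assumes "linear T" "linear R" "\<And>x. R (T x) = T (R x)"
  shows "R (poly_operator p T x) = poly_operator p T (R x)"
  by (induction p)
    (simp_all add: poly_operator_pCons[OF assms(1)] linear_0[OF assms(2)] linear_add[OF assms(2)]
      linear_scale[OF assms(2)] assms(3))

lemma poly_operator_pcompose:
  assumes "linear T"
  shows "poly_operator (pcompose p q) T x = poly_operator p (poly_operator q T) x"
proof -
  have lin: "linear (poly_operator q T)"
  proof (induction q)
    case 0
    then show ?case by (simp add: poly_operator_def module_hom_zero)
  next
    case (pCons a q)
    then show ?case
      by (intro linearI)
        (simp_all add: poly_operator_pCons[OF assms] linear_add linear_scale assms algebra_simps)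
  qed
  show ?thesis
    by (induction p arbitrary: x)
      (simp_all add: pcompose_pCons poly_operator_pCons[OF lin] poly_operator_pCons[OF assms]
        poly_operator_add[OF assms] poly_operator_mult[OF assms] linear_0[OF assms])
qed

lemma symmetric_poly_operator:
  assumes "symmetric_operator T"
  shows "symmetric_operator (poly_operator p T)"
proof -
  note lin = bounded_linear.linear[OF symmetric_operator_linear[OF assms]]
  show ?thesis
  proof (induction p)
    case 0
    then show ?case by (simp add: poly_operator_def symmetric_operator_def)
  next
    case (pCons a p)
    have "poly_operator (pCons a p) T = (\<lambda>x. a *\<^sub>R x + T (poly_operator p T x))"
      by (rule ext) (rule poly_operator_pCons[OF lin])
    then show ?case
      by (simp add: symmetric_operator_add symmetric_operator_scaleR symmetric_operator_id
          symmetric_operator_comp assms pCons.IH poly_operator_commute lin)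
  qed
qed

section \<open>Polynomials that are nonnegative on the unit interval\<close>

text \<open>
  Real polynomials are factored through their complex roots, so they have to be evaluated at
  complex points.
\<close>

definition complex_eval :: "real poly \<Rightarrow> complex \<Rightarrow> complex"
  where "complex_eval p z = poly (map_poly of_real p) z"

lemma complex_eval_pCons [simp]: "complex_eval (pCons a p) z = of_real a + z * complex_eval p z"
  by (simp add: complex_eval_def map_poly_pCons)

lemma complex_eval_0 [simp]: "complex_eval 0 z = 0"
  by (simp add: complex_eval_def)

lemma complex_eval_add: "complex_eval (p + q) z = complex_eval p z + complex_eval q z"
  by (induction p q rule: poly_induct2) (simp_all add: algebra_simps)

lemma complex_eval_smult: "complex_eval (smult c p) z = of_real c * complex_eval p z"
  by (induction p) (simp_all add: algebra_simps)

lemma complex_eval_mult: "complex_eval (p * q) z = complex_eval p z * complex_eval q z"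
  by (induction p) (simp_all add: complex_eval_add complex_eval_smult algebra_simps)

lemma complex_eval_of_real: "complex_eval p (of_real r) = of_real (poly p r)"
  by (induction p) simp_all

lemma real_quadratic_dvd:
  assumes "complex_eval p z = 0" "Im z \<noteq> 0"
  shows "[:(cmod z)\<^sup>2, - 2 * Re z, 1:] dvd p"
proof -
  define q where "q = [:(cmod z)\<^sup>2, - 2 * Re z, 1:]"
  define r where "r = p mod q"
  have "degree r \<le> 1"
    using degree_mod_less[of q p] by (auto simp: r_def q_def)
  then have r: "r = [:coeff r 0, coeff r 1:]"
    by (intro poly_eqI) (auto simp: coeff_pCons coeff_eq_0 split: nat.splits)
  have q0: "complex_eval q z = 0"
    by (simp add: q_def complex_eq_iff cmod_power2) (simp add: power2_eq_square algebra_simps)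
  have "p = q * (p div q) + r" by (simp add: r_def)
  then have "complex_eval p z = complex_eval q z * complex_eval (p div q) z + complex_eval r z"
    by (metis complex_eval_add complex_eval_mult)
  then have "complex_eval [:coeff r 0, coeff r 1:] z = 0" using assms(1) q0 r by simp
  then have "coeff r 1 = 0 \<and> coeff r 0 = 0"
    using assms(2) by (auto simp: complex_eq_iff)
  then have "r = 0" using r by simp
  then have "q dvd p" by (simp add: r_def mod_eq_0_iff_dvd)
  then show ?thesis by (simp add: q_def)
qed

lemma complex_eval_root:
  assumes "0 < degree p"
  obtains z where "complex_eval p z = 0"
proof -
  have "\<not> constant (poly (map_poly complex_of_real p))"
    using assms by (simp add: constant_degree degree_map_poly)
  then show ?thesis
    using fundamental_theorem_of_algebra that by (auto simp: complex_eval_def)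
qed

text \<open>
  Operators with \<open>0 \<le> T \<le> 1\<close>, under their name in quantum theory.
\<close>

definition effect :: "('h::real_inner \<Rightarrow> 'h) \<Rightarrow> bool"
  where "effect T \<longleftrightarrow> positive_operator T \<and> positive_operator (\<lambda>x. x - T x)"

lemma effect_symmetric: "effect T \<Longrightarrow> symmetric_operator T"
  by (simp add: effect_def positive_operator_symmetric)

lemma effect_bounded_linear: "effect T \<Longrightarrow> bounded_linear T"
  by (simp add: effect_symmetric symmetric_operator_linear)

lemma effect_linear: "effect T \<Longrightarrow> linear T"
  by (simp add: effect_bounded_linear bounded_linear.linear)

text \<open>
  The proof splits off one real factor that is positive on the unit interval and positive at \<open>T\<close>; products of
  commuting positive operators are positive.  A real root lies outside the unit interval
  because \<open>p\<close> is strictly positive there, so its linear factor is, up to sign, \<open>T - r\<close> with \<open>r < 0\<close> or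
  \<open>r - T\<close> with \<open>1 < r\<close>.  A nonreal root gives the factor \<open>(T - Re z)\<^sup>2 + (Im z)\<^sup>2\<close>.
\<close>

lemma positive_poly_operator_strict:
  assumes T: "effect T"
  shows "(\<And>t. 0 \<le> t \<Longrightarrow> t \<le> 1 \<Longrightarrow> 0 < poly p t) \<Longrightarrow> positive_operator (poly_operator p T)"
proof (induction "degree p" arbitrary: p rule: less_induct)
  case less
  note lin = effect_linear[OF T]
  have factor: "positive_operator (poly_operator p T)"
    if p: "p = f * q" and f: "positive_operator (poly_operator f T)" "0 < degree f"
      "\<And>t. 0 \<le> t \<Longrightarrow> t \<le> 1 \<Longrightarrow> 0 < poly f t" for f q
  proof -
    have q: "0 < poly q t" if "0 \<le> t" "t \<le> 1" for t
      using less.prems[OF that] f(3)[OF that] by (simp add: p zero_less_mult_iff)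
    have "q \<noteq> 0" using q[of 0] by auto
    then have "degree q < degree p" using f(2) unfolding p by (subst degree_mult_eq) auto
    then have "positive_operator (poly_operator q T)" using less.hyps q by blast
    moreover have "poly_operator f T (poly_operator q T x) = poly_operator q T (poly_operator f T x)" for x
      by (metis lin poly_operator_mult mult.commute)
    moreover have "poly_operator p T = (\<lambda>x. poly_operator f T (poly_operator q T x))"
      by (rule ext) (simp only: p poly_operator_mult[OF lin])
    ultimately show ?thesis
      using positive_operator_comp[OF _ f(1), of "poly_operator q T"] by simp
  qed
  show ?case
  proof (cases "degree p = 0")
    case True
    then obtain a where a: "p = [:a:]" using degree_eq_zeroE by blast
    moreover have "0 < a" using less.prems[of 0] a by simp
    ultimately show ?thesis
      using positive_operator_scaleR[OF positive_operator_id, of a]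
      by (simp add: poly_operator_pCons[OF lin, abs_def] linear_0[OF lin])
  next
    case False
    then obtain z where z: "complex_eval p z = 0" using complex_eval_root[of p] by auto
    show ?thesis
    proof (cases "Im z = 0")
      case True
      define r where "r = Re z"
      have "z = of_real r" using True by (simp add: r_def complex_eq_iff)
      then have root: "poly p r = 0" using z by (simp add: complex_eval_of_real)
      then have "r < 0 \<or> 1 < r" using less.prems[of r] by force
      then show ?thesis
      proof
        assume r: "r < 0"
        obtain q where "p = [:-r, 1:] * q" using root poly_eq_0_iff_dvd by (metis dvdE)
        moreover have "positive_operator (\<lambda>x. (-r) *\<^sub>R x + T x)"
          using r T positive_operator_scaleR[OF positive_operator_id, of "-r"]
          by (intro positive_operator_add) (auto simp: effect_def)
        then have "positive_operator (poly_operator [:-r, 1:] T)"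
          by (simp add: poly_operator_pCons[OF lin, abs_def] linear_0[OF lin])
        ultimately show ?thesis using r by (intro factor[of "[:-r, 1:]" q]) auto
      next
        assume r: "1 < r"
        obtain q where "p = [:-r, 1:] * q" using root poly_eq_0_iff_dvd by (metis dvdE)
        then have "p = [:r, -1:] * (- q)" by simp
        moreover have "positive_operator (\<lambda>x. (r - 1) *\<^sub>R x + (x - T x))"
          using r T positive_operator_scaleR[OF positive_operator_id, of "r - 1"]
          by (intro positive_operator_add) (auto simp: effect_def)
        then have "positive_operator (poly_operator [:r, -1:] T)"
          by (simp add: poly_operator_pCons[OF lin, abs_def] linear_0[OF lin] linear_neg[OF lin] algebra_simps)
        ultimately show ?thesis using r by (intro factor[of "[:r, -1:]" "-q"]) auto
      qed
    next
      case False
      define q where "q = [:(cmod z)\<^sup>2, - 2 * Re z, 1:]"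
      obtain q' where p: "p = q * q'" using real_quadratic_dvd[OF z False] by (auto simp: q_def)
      define U where "U = (\<lambda>x. T x - Re z *\<^sub>R x)"
      have eq: "poly_operator q T x = U (U x) + (Im z)\<^sup>2 *\<^sub>R x" for x
      proof -
        have "poly_operator q T x = ((Re z)\<^sup>2 + (Im z)\<^sup>2) *\<^sub>R x + (T (T x) - (2 * Re z) *\<^sub>R T x)"
          by (simp add: q_def poly_operator_pCons[OF lin] linear_0[OF lin] linear_diff[OF lin]
            linear_add[OF lin] linear_scale[OF lin] cmod_power2 algebra_simps)
        moreover have "U (U x) = T (T x) - (2 * Re z) *\<^sub>R T x + (Re z)\<^sup>2 *\<^sub>R x"
          by (simp add: U_def linear_diff[OF lin] linear_scale[OF lin] power2_eq_square
            algebra_simps flip: scaleR_scaleR)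
            (simp add: scaleR_2 algebra_simps)
        ultimately show ?thesis by (simp add: scaleR_add_left add_ac)
      qed
      have "symmetric_operator U" unfolding U_def
        by (rule symmetric_operator_diff[OF effect_symmetric[OF T] symmetric_operator_scaleR[OF symmetric_operator_id]])
      then have "positive_operator (\<lambda>x. U (U x) + (Im z)\<^sup>2 *\<^sub>R x)"
        by (intro positive_operator_add[OF positive_operator_square positive_operator_scaleR[OF positive_operator_id]]) auto
      moreover have "poly_operator q T = (\<lambda>x. U (U x) + (Im z)\<^sup>2 *\<^sub>R x)" by (rule ext) (rule eq)
      ultimately have "positive_operator (poly_operator q T)" by simp
      moreover have "0 < poly q t" for t
      proof -
        have "poly q t = (t - Re z)\<^sup>2 + (Im z)\<^sup>2"
          unfolding q_def cmod_power2 by (simp add: power2_eq_square algebra_simps)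
        then show ?thesis using False by (simp add: add_nonneg_pos)
      qed
      ultimately show ?thesis using p by (intro factor[of q q']) (auto simp: q_def)
    qed
  qed
qed

lemma poly_operator_nonneg:
  assumes T: "effect T" and p: "\<And>t. 0 \<le> t \<Longrightarrow> t \<le> 1 \<Longrightarrow> 0 \<le> poly p t"
  shows "0 \<le> inner (poly_operator p T x) x"
proof (rule field_le_epsilon)
  note lin = effect_linear[OF T]
  fix e :: real assume e: "0 < e"
  define d where "d = e / (inner x x + 1)"
  have xx: "0 \<le> inner x x" by simp
  have d: "0 < d" using e xx unfolding d_def by (intro divide_pos_pos) linarith+
  have "0 < poly (p + [:d:]) t" if "0 \<le> t" "t \<le> 1" for t
    using p[OF that] d by simp
  then have "positive_operator (poly_operator (p + [:d:]) T)"
    by (rule positive_poly_operator_strict[OF T])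
  then have "0 \<le> inner (poly_operator (p + [:d:]) T x) x" by (rule positive_operator_inner)
  also have "\<dots> = inner (poly_operator p T x) x + d * inner x x"
    by (simp add: poly_operator_add[OF lin] poly_operator_pCons[OF lin] linear_0[OF lin] inner_add_left)
  also have "d * inner x x \<le> e"
  proof -
    have "0 < inner x x + 1" using xx by linarith
    then show ?thesis using e by (simp add: d_def field_simps)
  qed
  finally show "0 \<le> inner (poly_operator p T x) x + e" by simp
qed

text \<open>
  The polynomial \<open>e\<^sup>2 - p\<^sup>2\<close> is nonnegative on the unit interval, and \<open>p(T)\<^sup>2\<close> has the quadratic form
  \<open>norm (p(T) x)\<^sup>2\<close>.
\<close>

lemma norm_poly_operator_le:
  assumes T: "effect T" and p: "\<And>t. 0 \<le> t \<Longrightarrow> t \<le> 1 \<Longrightarrow> \<bar>poly p t\<bar> \<le> e" and "0 \<le> e"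
  shows "norm (poly_operator p T x) \<le> e * norm x"
proof (rule power2_le_imp_le)
  note lin = effect_linear[OF T]
  have "0 \<le> poly ([:e\<^sup>2:] - p * p) t" if "0 \<le> t" "t \<le> 1" for t
    using power_mono[OF p[OF that], of 2] by (simp add: power2_eq_square)
  then have "0 \<le> inner (poly_operator ([:e\<^sup>2:] - p * p) T x) x" by (rule poly_operator_nonneg[OF T])
  then show "(norm (poly_operator p T x))\<^sup>2 \<le> (e * norm x)\<^sup>2"
    by (simp add: poly_operator_diff[OF lin] poly_operator_mult[OF lin] poly_operator_pCons[OF lin]
        linear_0[OF lin] inner_diff_left power_mult_distrib power2_norm_eq_inner
        symmetric_operator_inner[OF symmetric_poly_operator[OF effect_symmetric[OF T]]])
qed (use assms(3) in simp)

section \<open>Continuous functional calculus\<close>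

text \<open>
  The value \<open>f(T)\<close> is the limit of \<open>q\<^sub>n(T)\<close> for polynomials \<open>q\<^sub>n\<close> that converge to \<open>f\<close> uniformly on the unit
  interval.  The choice of the polynomials is immaterial by \<open>continuous_calculus_limit\<close>.
\<close>

definition continuous_calculus :: "('h::{real_inner,complete_space} \<Rightarrow> 'h) \<Rightarrow> (real \<Rightarrow> real) \<Rightarrow> 'h \<Rightarrow> 'h"
  where "continuous_calculus T f x =
    lim (\<lambda>n. poly_operator ((SOME q. uniform_limit {0..1} (\<lambda>n. poly (q n)) f sequentially) n) T x)"

lemma polynomial_approximation:
  assumes "continuous_on {a..b} (f :: real \<Rightarrow> real)"
  obtains q where "uniform_limit {a..b} (\<lambda>n. poly (q n)) f sequentially"
proof -
  obtain g where g: "uniform_limit {a..b} g f sequentially" "\<And>n. polynomial_function (g n)"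
    using Stone_Weierstrass_uniform_limit[OF _ assms] by auto
  have "\<exists>p. g n = poly p" for n
  proof -
    have "real_polynomial_function (g n)" using g(2) by (simp add: real_polynomial_function_eq)
    then obtain c m where "g n = (\<lambda>x. \<Sum>i\<le>m. c i * x ^ i)"
      using real_polynomial_function_iff_sum by blast
    then have "g n = poly (\<Sum>i\<le>m. monom (c i) i)"
      by (simp add: fun_eq_iff poly_sum poly_monom)
    then show ?thesis by blast
  qed
  then obtain q where "\<And>n. g n = poly (q n)" by metis
  then have "uniform_limit {a..b} (\<lambda>n. poly (q n)) f sequentially" using g(1) by presburger
  then show ?thesis by (rule that)
qed

lemma poly_operator_uniformly_null:
  assumes T: "effect T" and q: "uniform_limit {0..1} (\<lambda>n. poly (q n)) (\<lambda>_. 0) sequentially"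
  shows "(\<lambda>n. poly_operator (q n) T x) \<longlonglongrightarrow> 0"
proof (rule LIMSEQ_I)
  fix e :: real assume e: "0 < e"
  define d where "d = e / (norm x + 1)"
  have "0 < norm x + 1" by (simp add: add_nonneg_pos)
  then have d: "0 < d" "d * norm x < e"
    using e by (auto simp: d_def field_simps)
  obtain N where "\<forall>n\<ge>N. \<forall>t\<in>{0..1}. \<bar>poly (q n) t\<bar> < d"
    using uniform_limitD[OF q d(1)] by (auto simp: eventually_sequentially)
  then have "norm (poly_operator (q n) T x) \<le> d * norm x" if "N \<le> n" for n
    using that d by (intro norm_poly_operator_le[OF T]) (auto intro: less_imp_le)
  then show "\<exists>N. \<forall>n\<ge>N. norm (poly_operator (q n) T x - 0) < e"
    using d(2) by (metis diff_zero le_less_trans)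
qed

lemma poly_operator_convergent:
  fixes T :: "'h::{real_inner,complete_space} \<Rightarrow> 'h"
  assumes T: "effect T" and q: "uniform_limit {0..1} (\<lambda>n. poly (q n)) f sequentially"
  shows "convergent (\<lambda>n. poly_operator (q n) T x)"
proof -
  note lin = effect_linear[OF T]
  have "Cauchy (\<lambda>n. poly_operator (q n) T x)"
  proof (rule CauchyI)
    fix e :: real assume e: "0 < e"
    define d where "d = e / (norm x + 1)"
    have "0 < norm x + 1" by (simp add: add_nonneg_pos)
    then have d: "0 < d" "d * norm x < e"
      using e by (auto simp: d_def field_simps)
    then have "0 < d / 2" by simp
    then obtain N where N: "\<And>n t. N \<le> n \<Longrightarrow> t \<in> {0..1} \<Longrightarrow> dist (poly (q n) t) (f t) < d / 2"
      using uniform_limitD[OF q] unfolding eventually_sequentially by meson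
    have "norm (poly_operator (q m) T x - poly_operator (q n) T x) < e" if "N \<le> m" "N \<le> n" for m n
    proof -
      have "\<bar>poly (q m - q n) t\<bar> \<le> d" if t: "0 \<le> t" "t \<le> 1" for t
      proof -
        have "\<bar>poly (q m) t - f t\<bar> < d / 2" "\<bar>poly (q n) t - f t\<bar> < d / 2"
          using N[OF \<open>N \<le> m\<close>, of t] N[OF \<open>N \<le> n\<close>, of t] t by (simp_all add: dist_real_def)
        then show ?thesis unfolding poly_diff by linarith
      qed
      then have "norm (poly_operator (q m - q n) T x) \<le> d * norm x"
        using d by (intro norm_poly_operator_le[OF T]) auto
      then show ?thesis using d(2) by (simp add: poly_operator_diff[OF lin])
    qed
    then show "\<exists>M. \<forall>m\<ge>M. \<forall>n\<ge>M. norm (poly_operator (q m) T x - poly_operator (q n) T x) < e"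
      by blast
  qed
  then show ?thesis by (simp add: Cauchy_convergent_iff)
qed

lemma continuous_calculus_limit:
  assumes T: "effect T" and q: "uniform_limit {0..1} (\<lambda>n. poly (q n)) f sequentially"
  shows "(\<lambda>n. poly_operator (q n) T x) \<longlonglongrightarrow> continuous_calculus T f x"
proof -
  note lin = effect_linear[OF T]
  define r where "r = (SOME q. uniform_limit {0..1} (\<lambda>n. poly (q n)) f sequentially)"
  have r: "uniform_limit {0..1} (\<lambda>n. poly (r n)) f sequentially"
    using someI[of "\<lambda>q. uniform_limit {0..1} (\<lambda>n. poly (q n)) f sequentially", OF q] by (simp add: r_def)
  have 1: "(\<lambda>n. poly_operator (r n) T x) \<longlonglongrightarrow> continuous_calculus T f x"
    using poly_operator_convergent[OF T r] by (simp add: continuous_calculus_def convergent_LIMSEQ_iff flip: r_def)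
  have "uniform_limit {0..1} (\<lambda>n. poly (q n - r n)) (\<lambda>_. 0) sequentially"
    using uniform_limit_minus[OF q r] by (simp add: poly_diff[abs_def] cong: uniform_limit_cong')
  then have "(\<lambda>n. poly_operator (q n - r n) T x) \<longlonglongrightarrow> 0"
    by (rule poly_operator_uniformly_null[OF T])
  from tendsto_add[OF this 1] show ?thesis
    by (simp add: poly_operator_diff[OF lin])
qed

lemma continuous_calculus_poly:
  assumes "effect T" "\<And>t. 0 \<le> t \<Longrightarrow> t \<le> 1 \<Longrightarrow> f t = poly p t"
  shows "continuous_calculus T f x = poly_operator p T x"
proof -
  have "uniform_limit {0..1} (\<lambda>n::nat. poly p) f sequentially"
    using assms(2) by (auto intro!: uniform_limitI simp: eventually_sequentially)
  then show ?thesis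
    using LIMSEQ_unique[OF continuous_calculus_limit[OF assms(1)] tendsto_const] by blast
qed

lemma continuous_calculus_diff:
  assumes T: "effect T" and f: "continuous_on {0..1} f" and g: "continuous_on {0..1} g"
  shows "continuous_calculus T (\<lambda>t. f t - g t) x = continuous_calculus T f x - continuous_calculus T g x"
proof -
  obtain q where q: "uniform_limit {0..1} (\<lambda>n. poly (q n)) f sequentially"
    by (rule polynomial_approximation[OF f])
  obtain r where r: "uniform_limit {0..1} (\<lambda>n. poly (r n)) g sequentially"
    by (rule polynomial_approximation[OF g])
  have "uniform_limit {0..1} (\<lambda>n. poly (q n - r n)) (\<lambda>t. f t - g t) sequentially"
    using uniform_limit_minus[OF q r] by (simp add: poly_diff[abs_def] cong: uniform_limit_cong')
  then have "(\<lambda>n. poly_operator (q n - r n) T x) \<longlonglongrightarrow> continuous_calculus T (\<lambda>t. f t - g t) x"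
    by (rule continuous_calculus_limit[OF T])
  moreover have "(\<lambda>n. poly_operator (q n - r n) T x) \<longlonglongrightarrow> continuous_calculus T f x - continuous_calculus T g x"
    unfolding poly_operator_diff[OF effect_linear[OF T]]
    by (intro tendsto_diff continuous_calculus_limit T q r)
  ultimately show ?thesis using LIMSEQ_unique by blast
qed

text \<open>
  It suffices that \<open>R\<close> commutes with the approximating polynomials, even if it does not commute
  with \<open>T\<close>.  This is how functions that are symmetric about a center are handled.
\<close>

lemma continuous_calculus_commute_approx:
  assumes T: "effect T" and q: "uniform_limit {0..1} (\<lambda>n. poly (q n)) f sequentially"
    and R: "bounded_linear R" and comm: "\<And>n x. R (poly_operator (q n) T x) = poly_operator (q n) T (R x)"
  shows "R (continuous_calculus T f x) = continuous_calculus T f (R x)"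
proof -
  have "(\<lambda>n. R (poly_operator (q n) T x)) \<longlonglongrightarrow> R (continuous_calculus T f x)"
    by (intro bounded_linear.tendsto[OF R] continuous_calculus_limit T q)
  moreover have "(\<lambda>n. R (poly_operator (q n) T x)) \<longlonglongrightarrow> continuous_calculus T f (R x)"
    unfolding comm by (intro continuous_calculus_limit T q)
  ultimately show ?thesis using LIMSEQ_unique by blast
qed

lemma continuous_calculus_commute:
  assumes T: "effect T" and f: "continuous_on {0..1} f"
    and R: "bounded_linear R" and comm: "\<And>x. R (T x) = T (R x)"
  shows "R (continuous_calculus T f x) = continuous_calculus T f (R x)"
proof -
  obtain q where q: "uniform_limit {0..1} (\<lambda>n. poly (q n)) f sequentially"
    by (rule polynomial_approximation[OF f])
  show ?thesis
    by (rule continuous_calculus_commute_approx[OF T q R])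
      (rule poly_operator_commute[OF effect_linear[OF T] bounded_linear.linear[OF R] comm])
qed

lemma poly_operator_eventually_bounded:
  assumes T: "effect T" and f: "continuous_on {0..1} f"
    and q: "uniform_limit {0..1} (\<lambda>n. poly (q n)) f sequentially"
  obtains K where "\<forall>\<^sub>F n in sequentially. \<forall>x. norm (poly_operator (q n) T x) \<le> K * norm x"
proof -
  have "compact (f ` {0..1})" by (rule compact_continuous_image[OF f]) simp
  then obtain M where M: "\<And>t. t \<in> {0..1} \<Longrightarrow> \<bar>f t\<bar> \<le> M"
    using compact_imp_bounded bounded_iff by (metis imageI real_norm_def)
  have "\<forall>\<^sub>F n in sequentially. \<forall>t\<in>{0..1}. dist (poly (q n) t) (f t) < 1"
    by (rule uniform_limitD[OF q]) simp
  then have "\<forall>\<^sub>F n in sequentially. \<forall>x. norm (poly_operator (q n) T x) \<le> (M + 1) * norm x"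
  proof eventually_elim
    case (elim n)
    have "\<bar>poly (q n) t\<bar> \<le> M + 1" if "0 \<le> t" "t \<le> 1" for t
      using bspec[OF elim, of t] M[of t] that by (simp add: dist_real_def)
    moreover have "0 \<le> M + 1" using M[of 0] by simp
    ultimately show ?case using norm_poly_operator_le[OF T] by blast
  qed
  then show ?thesis by (rule that)
qed

lemma bounded_linear_continuous_calculus:
  assumes T: "effect T" and f: "continuous_on {0..1} f"
  shows "bounded_linear (continuous_calculus T f)"
proof -
  note lin = bounded_linear.linear[OF bounded_linear_poly_operator[OF effect_bounded_linear[OF T]]]
  obtain q where q: "uniform_limit {0..1} (\<lambda>n. poly (q n)) f sequentially"
    by (rule polynomial_approximation[OF f])
  note lim = continuous_calculus_limit[OF T q]
  obtain K where K: "\<forall>\<^sub>F n in sequentially. \<forall>x. norm (poly_operator (q n) T x) \<le> K * norm x"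
    by (rule poly_operator_eventually_bounded[OF T f q])
  show ?thesis
  proof (rule bounded_linear_intro)
    fix x y
    have "(\<lambda>n. poly_operator (q n) T (x + y)) \<longlonglongrightarrow> continuous_calculus T f x + continuous_calculus T f y"
      unfolding linear_add[OF lin] by (intro tendsto_add lim)
    then show "continuous_calculus T f (x + y) = continuous_calculus T f x + continuous_calculus T f y"
      using LIMSEQ_unique lim by blast
  next
    fix c x
    have "(\<lambda>n. poly_operator (q n) T (c *\<^sub>R x)) \<longlonglongrightarrow> c *\<^sub>R continuous_calculus T f x"
      unfolding linear_scale[OF lin] by (intro tendsto_scaleR tendsto_const lim)
    then show "continuous_calculus T f (c *\<^sub>R x) = c *\<^sub>R continuous_calculus T f x"
      using LIMSEQ_unique lim by blast
  next
    fix x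
    have "\<forall>\<^sub>F n in sequentially. norm (poly_operator (q n) T x) \<le> K * norm x"
      using K by (rule eventually_mono) blast
    then show "norm (continuous_calculus T f x) \<le> norm x * K"
      using tendsto_upperbound[OF tendsto_norm[OF lim[of x]]] by (simp add: mult.commute)
  qed
qed

lemma continuous_calculus_mult:
  assumes T: "effect T" and f: "continuous_on {0..1} f" and g: "continuous_on {0..1} g"
  shows "continuous_calculus T (\<lambda>t. f t * g t) x = continuous_calculus T f (continuous_calculus T g x)"
proof -
  define y where "y = continuous_calculus T g x"
  note lin = effect_linear[OF T]
  note lin' = bounded_linear.linear[OF bounded_linear_poly_operator[OF effect_bounded_linear[OF T]]]
  obtain q where q: "uniform_limit {0..1} (\<lambda>n. poly (q n)) f sequentially"
    by (rule polynomial_approximation[OF f])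
  obtain r where r: "uniform_limit {0..1} (\<lambda>n. poly (r n)) g sequentially"
    by (rule polynomial_approximation[OF g])
  obtain K where K: "\<forall>\<^sub>F n in sequentially. \<forall>x. norm (poly_operator (q n) T x) \<le> K * norm x"
    by (rule poly_operator_eventually_bounded[OF T f q])
  have "bounded (f ` {0..1})" "bounded (g ` {0..1})"
    using compact_continuous_image[OF f] compact_continuous_image[OF g] compact_imp_bounded by auto
  then have "uniform_limit {0..1} (\<lambda>n. poly (q n * r n)) (\<lambda>t. f t * g t) sequentially"
    using uniform_lim_mult[OF q r] unfolding poly_mult[abs_def] by simp
  then have 1: "(\<lambda>n. poly_operator (q n * r n) T x) \<longlonglongrightarrow> continuous_calculus T (\<lambda>t. f t * g t) x"
    by (rule continuous_calculus_limit[OF T])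
  have "(\<lambda>n. poly_operator (r n) T x - y) \<longlonglongrightarrow> 0"
    using continuous_calculus_limit[OF T r] by (simp add: y_def LIM_zero)
  then have null: "(\<lambda>n. K * norm (poly_operator (r n) T x - y)) \<longlonglongrightarrow> 0"
    by (intro tendsto_mult_right_zero tendsto_norm_zero)
  have "(\<lambda>n. poly_operator (q n) T (poly_operator (r n) T x - y)) \<longlonglongrightarrow> 0"
    by (rule Lim_null_comparison[OF _ null]) (use K in \<open>auto elim: eventually_mono\<close>)
  from tendsto_add[OF this continuous_calculus_limit[OF T q, of y]]
  have "(\<lambda>n. poly_operator (q n * r n) T x) \<longlonglongrightarrow> continuous_calculus T f y"
    by (simp add: poly_operator_mult[OF lin] linear_diff[OF lin'])
  with 1 show ?thesis unfolding y_def using LIMSEQ_unique by blast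
qed

lemma continuous_calculus_nonneg:
  assumes T: "effect T" and f: "continuous_on {0..1} f" "\<And>t. t \<in> {0..1} \<Longrightarrow> 0 \<le> f t"
  shows "0 \<le> inner (continuous_calculus T f x) x"
proof (rule field_le_epsilon)
  fix e :: real assume e: "0 < e"
  note lin = effect_linear[OF T]
  define d where "d = e / (inner x x + 1)"
  have xx: "0 < inner x x + 1" by (rule add_nonneg_pos) auto
  then have d: "0 < d" "d * inner x x \<le> e" using e by (auto simp: d_def field_simps)
  obtain q where q: "uniform_limit {0..1} (\<lambda>n. poly (q n)) f sequentially"
    by (rule polynomial_approximation[OF f(1)])
  have "\<forall>\<^sub>F n in sequentially. \<forall>t\<in>{0..1}. dist (poly (q n) t) (f t) < d"
    by (rule uniform_limitD[OF q d(1)])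
  then have "\<forall>\<^sub>F n in sequentially. 0 \<le> inner (poly_operator (q n) T x) x + e"
  proof eventually_elim
    case (elim n)
    have "0 \<le> poly (q n + [:d:]) t" if "0 \<le> t" "t \<le> 1" for t
      using bspec[OF elim, of t] f(2)[of t] that by (simp add: dist_real_def)
    then have "0 \<le> inner (poly_operator (q n + [:d:]) T x) x" by (rule poly_operator_nonneg[OF T])
    then show ?case using d(2)
      by (simp add: poly_operator_add[OF lin] poly_operator_pCons[OF lin] linear_0[OF lin] inner_add_left)
  qed
  moreover have "(\<lambda>n. inner (poly_operator (q n) T x) x + e) \<longlonglongrightarrow> inner (continuous_calculus T f x) x + e"
    by (intro tendsto_intros continuous_calculus_limit T q)
  ultimately show "0 \<le> inner (continuous_calculus T f x) x + e"
    by (intro tendsto_lowerbound) auto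
qed

lemma symmetric_continuous_calculus:
  assumes T: "effect T" and f: "continuous_on {0..1} f"
  shows "symmetric_operator (continuous_calculus T f)"
proof -
  obtain q where q: "uniform_limit {0..1} (\<lambda>n. poly (q n)) f sequentially"
    by (rule polynomial_approximation[OF f])
  note lim = continuous_calculus_limit[OF T q]
  have "inner (continuous_calculus T f x) y = inner x (continuous_calculus T f y)" for x y
  proof (rule LIMSEQ_unique)
    show "(\<lambda>n. inner (poly_operator (q n) T x) y) \<longlonglongrightarrow> inner (continuous_calculus T f x) y"
      by (intro tendsto_intros lim)
    show "(\<lambda>n. inner (poly_operator (q n) T x) y) \<longlonglongrightarrow> inner x (continuous_calculus T f y)"
      unfolding symmetric_operator_inner[OF symmetric_poly_operator[OF effect_symmetric[OF T]]]
      by (intro tendsto_intros lim)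
  qed
  then show ?thesis
    using bounded_linear_continuous_calculus[OF T f] by (simp add: symmetric_operator_def)
qed

section \<open>Level sets and eigenvectors\<close>

lemma eigenvector_of_poly_root:
  fixes T :: "'h::real_normed_vector \<Rightarrow> 'h"
  assumes "finite F" "linear T" "x \<noteq> 0" "poly_operator (\<Prod>r\<in>F. [:-r, 1:]) T x = 0"
  shows "\<exists>r\<in>F. \<exists>y. y \<noteq> 0 \<and> T y = r *\<^sub>R y"
  using assms(1,4)
proof (induction F rule: finite_induct)
  case empty
  then show ?case using assms(2,3)
    by (simp add: one_pCons poly_operator_pCons linear_0)
next
  case (insert r F)
  show ?case
  proof (cases "poly_operator (\<Prod>r\<in>F. [:-r, 1:]) T x = 0")
    case True
    then show ?thesis using insert.IH by blast
  next
    case False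
    have "poly_operator [:-r, 1:] T (poly_operator (\<Prod>r\<in>F. [:-r, 1:]) T x) = 0"
      using insert by (simp add: poly_operator_mult[OF assms(2), symmetric])
    then have "T (poly_operator (\<Prod>r\<in>F. [:-r, 1:]) T x) = r *\<^sub>R poly_operator (\<Prod>r\<in>F. [:-r, 1:]) T x"
      by (simp add: poly_operator_pCons[OF assms(2)] linear_0[OF assms(2)] algebra_simps)
    then show ?thesis using False by blast
  qed
qed

lemma poly_operator_eigenvector:
  assumes "linear T" "T x = l *\<^sub>R x"
  shows "poly_operator p T x = poly p l *\<^sub>R x"
  by (induction p)
    (simp_all add: poly_operator_pCons[OF assms(1)] linear_scale[OF assms(1)] assms(2) algebra_simps)

text \<open>
  Suppose that \<open>c(T)\<close> is the scalar \<open>k\<close>.  As \<open>p\<close> vanishes wherever \<open>c = k\<close>, compactness gives, for each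
  \<open>d > 0\<close>, a constant \<open>L\<close> with \<open>p\<^sup>2 \<le> d + L (c - k)\<^sup>2\<close> on the unit interval.  Applied to \<open>T\<close>, the last
  term disappears, so \<open>norm (p(T) x)\<^sup>2 \<le> d (norm x)\<^sup>2\<close> for all \<open>d > 0\<close>.
\<close>

lemma level_set_poly_operator:
  assumes T: "effect T" and c: "continuous_on {0..1} c"
    and scalar: "\<And>x. continuous_calculus T c x = k *\<^sub>R x"
    and p: "\<And>t. t \<in> {0..1} \<Longrightarrow> c t = k \<Longrightarrow> poly p t = 0"
  shows "poly_operator p T x = 0"
proof -
  note lin = effect_linear[OF T]
  have bound: "(norm (poly_operator p T x))\<^sup>2 \<le> e" if e: "0 < e" for e
  proof -
    define d where "d = e / (inner x x + 1)"
    have xx: "0 < inner x x + 1" by (rule add_nonneg_pos) auto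
    then have d: "0 < d" "d * inner x x \<le> e" using e by (auto simp: d_def field_simps)
    have contp: "continuous_on A (\<lambda>t. (poly p t)\<^sup>2)" for A by (intro continuous_intros)
    define S where "S = {0..1} \<inter> {t. d \<le> (poly p t)\<^sup>2}"
    have "closed {t. d \<le> (poly p t)\<^sup>2}"
      by (intro closed_Collect_le continuous_intros)
    then have "compact S" unfolding S_def by (intro compact_Int_closed) auto
    obtain M where M: "\<And>t. t \<in> {0..1} \<Longrightarrow> (poly p t)\<^sup>2 \<le> M"
      using continuous_attains_sup[OF compact_Icc _ contp, of 0 1] by (metis atLeastatMost_empty_iff2 zero_le_one)
    obtain L where L: "0 \<le> L" "\<And>t. t \<in> {0..1} \<Longrightarrow> (poly p t)\<^sup>2 \<le> d + L * (c t - k)\<^sup>2"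
    proof (cases "S = {}")
      case True
      then have "(poly p t)\<^sup>2 \<le> d + 0 * (c t - k)\<^sup>2" if "t \<in> {0..1}" for t
        using that by (auto simp: S_def not_le intro: less_imp_le)
      then show ?thesis using that[of 0] by simp
    next
      case False
      have "S \<subseteq> {0..1}" by (simp add: S_def)
      then have "continuous_on S (\<lambda>t. (c t - k)\<^sup>2)"
        by (intro continuous_intros continuous_on_subset[OF c])
      then obtain s where s: "s \<in> S" "\<And>t. t \<in> S \<Longrightarrow> (c s - k)\<^sup>2 \<le> (c t - k)\<^sup>2"
        using continuous_attains_inf[OF \<open>compact S\<close> False] by blast
      define m where "m = (c s - k)\<^sup>2"
      have "c s \<noteq> k" using s(1) p[of s] d(1) by (auto simp: S_def)
      then have m: "0 < m" by (simp add: m_def)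
      have M0: "0 \<le> M" using M[of 0] by (meson atLeastAtMost_iff order.trans zero_le_power2 order_refl zero_le_one)
      have "(poly p t)\<^sup>2 \<le> d + (M / m) * (c t - k)\<^sup>2" if t: "t \<in> {0..1}" for t
      proof (cases "t \<in> S")
        case True
        have "(poly p t)\<^sup>2 \<le> M" by (rule M[OF t])
        also have "M = (M / m) * m" using m by simp
        also have "\<dots> \<le> (M / m) * (c t - k)\<^sup>2"
          using s(2)[OF True] M0 m by (intro mult_left_mono) (auto simp: m_def)
        finally show ?thesis using d(1) by simp
      next
        case False
        then have "(poly p t)\<^sup>2 < d" using t by (simp add: S_def)
        moreover have "0 \<le> (M / m) * (c t - k)\<^sup>2" using M0 m by simp
        ultimately show ?thesis by linarith
      qed
      moreover have "0 \<le> M / m" using M0 m by simp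
      ultimately show ?thesis using that by blast
    qed
    define g where "g = (\<lambda>t. c t - k)"
    have g: "continuous_on {0..1} g" unfolding g_def by (intro continuous_intros c)
    have g0: "continuous_calculus T g y = 0" for y
      unfolding g_def using continuous_calculus_diff[OF T c, of "\<lambda>_. k" y]
        continuous_calculus_poly[OF T, of "\<lambda>_. k" "[:k:]" y]
      by (simp add: scalar poly_operator_pCons[OF lin] linear_0[OF lin])
    define f where "f = (\<lambda>t. poly ([:d:] - p * p) t - (- L) * (g t * g t))"
    have "0 \<le> f t" if "t \<in> {0..1}" for t
      using L(2)[OF that] by (simp add: f_def g_def power2_eq_square)
    moreover have "continuous_on {0..1} f" unfolding f_def by (intro continuous_intros g)
    ultimately have "0 \<le> inner (continuous_calculus T f x) x"
      by (intro continuous_calculus_nonneg[OF T])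
    moreover have "continuous_calculus T f x = poly_operator ([:d:] - p * p) T x"
    proof -
      have "continuous_calculus T (\<lambda>t. (- L) * (g t * g t)) x
          = continuous_calculus T (\<lambda>_. - L) (continuous_calculus T g (continuous_calculus T g x))"
        using g by (subst continuous_calculus_mult[OF T]) (auto intro!: continuous_intros simp: continuous_calculus_mult[OF T])
      also have "\<dots> = 0"
        by (simp add: g0 linear_0 bounded_linear.linear[OF bounded_linear_continuous_calculus[OF T]])
      finally show ?thesis
        unfolding f_def using g
        by (subst continuous_calculus_diff[OF T])
          (auto intro!: continuous_intros simp: continuous_calculus_poly[OF T])
    qed
    moreover have "inner (poly_operator p T (poly_operator p T x)) x = (norm (poly_operator p T x))\<^sup>2"
      by (simp add: symmetric_operator_inner[OF symmetric_poly_operator[OF effect_symmetric[OF T]]] power2_norm_eq_inner)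
    ultimately have "(norm (poly_operator p T x))\<^sup>2 \<le> d * inner x x"
      by (simp add: poly_operator_diff[OF lin] poly_operator_mult[OF lin] poly_operator_pCons[OF lin]
          linear_0[OF lin] inner_diff_left)
    then show ?thesis using d(2) by linarith
  qed
  have "(norm (poly_operator p T x))\<^sup>2 \<le> 0"
    by (rule field_le_epsilon, subst add_0_left, rule bound)
  then show ?thesis by simp
qed

section \<open>Spans and orthogonal projections in complex Hilbert spaces\<close>

lemma norm_scaleC: "norm (c *\<^sub>C (x :: 'h::complex_inner)) = cmod c * norm x"
proof -
  have "complex_of_real ((norm (c *\<^sub>C x))\<^sup>2) = cinner (c *\<^sub>C x) (c *\<^sub>C x)" by (rule cinner_self[symmetric])
  also have "\<dots> = c * cnj (cinner (c *\<^sub>C x) x)" by (subst cinner_commute[symmetric]) (rule cinner_scaleC_left)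
  also have "\<dots> = (c * cnj c) * cinner x x"
    by (simp add: cinner_scaleC_left cinner_self)
  also have "\<dots> = complex_of_real ((cmod c * norm x)\<^sup>2)"
    by (simp add: cinner_self power_mult_distrib complex_norm_square[symmetric] del: of_real_power)
  finally have "(norm (c *\<^sub>C x))\<^sup>2 = (cmod c * norm x)\<^sup>2" using of_real_eq_iff by blast
  then show ?thesis by (simp add: power2_eq_iff_nonneg)
qed

lemma scaleR_scaleC: "r *\<^sub>R (x :: 'h::complex_inner) = complex_of_real r *\<^sub>C x"
  by (rule scaleC_complex_of_real[symmetric])

lemma bounded_linear_scaleC: "bounded_linear (\<lambda>x :: 'h::complex_inner. c *\<^sub>C x)"
  by (rule bounded_linear_intro[of _ "cmod c"])
    (simp_all add: scaleC_add_right scaleR_scaleC scaleC_scaleC norm_scaleC mult.commute)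

lemma bounded_linear_scaleC_left: "bounded_linear (\<lambda>c. c *\<^sub>C (x :: 'h::complex_inner))"
  by (rule bounded_linear_intro[of _ "norm x"])
    (simp_all add: scaleC_add_left scaleR_scaleC[of _ x] scaleR_scaleC[of _ "_ *\<^sub>C x"]
      scaleC_scaleC norm_scaleC scaleR_conv_of_real)

text \<open>
  If \<open>x\<close> has a positive distance \<open>d\<close> to the closed span \<open>M\<close>, then \<open>norm (m + k x) \<ge> d \<bar>k\<bar>\<close> for \<open>m \<in> M\<close>.
  So along a convergent sequence in the larger span the coefficients of \<open>x\<close> form a Cauchy sequence.
\<close>

lemma closed_span_insert:
  fixes x :: "'h::complex_inner"
  assumes "closed (complex_vector.span S)"
  shows "closed (complex_vector.span (insert x S))"
proof (cases "x \<in> complex_vector.span S")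
  case True
  then show ?thesis using assms by (simp add: complex_vector.span_redundant)
next
  case False
  let ?M = "complex_vector.span S"
  obtain d where d: "0 < d" "ball x d \<subseteq> - ?M"
    using False assms by (meson ComplI open_Compl open_contains_ball)
  have far: "d * cmod k \<le> norm y" if "y - k *\<^sub>C x \<in> ?M" for y k
  proof (cases "k = 0")
    case False
    have "(1/k) *\<^sub>C (y - k *\<^sub>C x) \<in> ?M" using that by (rule complex_vector.span_scale)
    then have "x - (1/k) *\<^sub>C y \<in> ?M"
      using complex_vector.span_neg False
      by (force simp: complex_vector.scale_right_diff_distrib scaleC_scaleC)
    then have "x - (1/k) *\<^sub>C y \<notin> ball x d" using d(2) by blast
    then have "d \<le> norm ((1/k) *\<^sub>C y)" by (simp add: dist_norm)
    then show ?thesis using False by (simp add: norm_scaleC norm_divide field_simps)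
  qed simp
  show ?thesis
    unfolding closed_sequential_limits
  proof (intro allI impI, elim conjE)
    fix y l assume y: "\<forall>n. y n \<in> complex_vector.span (insert x S)" and l: "y \<longlonglongrightarrow> l"
    have "\<forall>n. \<exists>k. y n - k *\<^sub>C x \<in> ?M" using y by (simp add: complex_vector.span_insert)
    then obtain k where k: "\<And>n. y n - k n *\<^sub>C x \<in> ?M" by metis
    have kd: "d * cmod (k m - k n) \<le> norm (y m - y n)" for m n
    proof (rule far)
      have "(y m - k m *\<^sub>C x) - (y n - k n *\<^sub>C x) \<in> ?M" by (intro complex_vector.span_diff k)
      then show "y m - y n - (k m - k n) *\<^sub>C x \<in> ?M"
        by (simp add: complex_vector.scale_left_diff_distrib algebra_simps)
    qed
    have "Cauchy k"
    proof (rule CauchyI)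
      fix e :: real assume "0 < e"
      then have "0 < d * e" using d(1) by simp
      then obtain N where "\<forall>m\<ge>N. \<forall>n\<ge>N. norm (y m - y n) < d * e"
        using CauchyD[OF LIMSEQ_imp_Cauchy[OF l]] by blast
      then have "\<forall>m\<ge>N. \<forall>n\<ge>N. d * cmod (k m - k n) < d * e"
        using kd le_less_trans by blast
      then show "\<exists>N. \<forall>m\<ge>N. \<forall>n\<ge>N. cmod (k m - k n) < e"
        using d(1) by auto
    qed
    then obtain c where "k \<longlonglongrightarrow> c" using Cauchy_convergent convergent_def by blast
    then have "(\<lambda>n. y n - k n *\<^sub>C x) \<longlonglongrightarrow> l - c *\<^sub>C x"
      by (intro tendsto_diff l bounded_linear.tendsto[OF bounded_linear_scaleC_left])
    then have "l - c *\<^sub>C x \<in> ?M"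
      by (rule closed_sequentially[OF assms k])
    then show "l \<in> complex_vector.span (insert x S)"
      by (auto simp: complex_vector.span_insert)
  qed
qed

lemma closed_finite_span:
  "finite B \<Longrightarrow> closed (complex_vector.span (B :: 'h::complex_inner set))"
  by (induction B rule: finite_induct) (simp_all add: closed_span_insert)

text \<open>
  A finite-dimensional subspace is closed, so irreducibility applies to it.
\<close>

lemma irreducible_finite_span:
  assumes irr: "irreducible_family S P" and lin: "\<And>g. g \<in> S \<Longrightarrow> bounded_linear (P g)"
    "\<And>g c x. g \<in> S \<Longrightarrow> P g (c *\<^sub>C x) = c *\<^sub>C P g x"
    and B: "finite B" "x \<in> B" "x \<noteq> 0" "\<And>g y. g \<in> S \<Longrightarrow> y \<in> B \<Longrightarrow> P g y \<in> complex_vector.span B"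
  shows "complex_vector.span B = UNIV"
proof -
  let ?M = "complex_vector.span B"
  have "P g y \<in> ?M" if "g \<in> S" "y \<in> ?M" for g y
    using that(2)
  proof (induction rule: complex_vector.span_induct_alt)
    case base
    then show ?case
      by (simp add: linear_0[OF bounded_linear.linear[OF lin(1)[OF that(1)]]] complex_vector.span_zero)
  next
    case (step c x y)
    then show ?case
      by (simp add: linear_add[OF bounded_linear.linear[OF lin(1)[OF that(1)]]] lin(2)[OF that(1)]
          complex_vector.span_add complex_vector.span_scale B(4)[OF that(1)])
  qed
  then have "?M = {0} \<or> ?M = UNIV"
    using irr closed_finite_span[OF B(1)] complex_vector.subspace_span
    unfolding irreducible_family_def by blast
  then show ?thesis using B(2,3) complex_vector.span_base by blast
qed

lemma orthogonal_projection_bounded_linear: "orthogonal_projection P \<Longrightarrow> bounded_linear P"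
  by (simp add: orthogonal_projection_def)

lemma orthogonal_projection_scaleC: "orthogonal_projection P \<Longrightarrow> P (c *\<^sub>C x) = c *\<^sub>C P x"
  by (simp add: orthogonal_projection_def)

lemma orthogonal_projection_idem: "orthogonal_projection P \<Longrightarrow> P (P x) = P x"
  by (simp add: orthogonal_projection_def fun_eq_iff)

lemma orthogonal_projection_symmetric: "orthogonal_projection P \<Longrightarrow> symmetric_operator P"
  unfolding orthogonal_projection_def symmetric_operator_def by (metis Re_cinner)

lemma orthogonal_projection_inner_self:
  assumes "orthogonal_projection P"
  shows "inner (P x) x = (norm (P x))\<^sup>2"
  by (metis assms orthogonal_projection_idem orthogonal_projection_symmetric power2_norm_eq_inner
      symmetric_operator_inner)

lemma orthogonal_projection_norm_le:
  assumes "orthogonal_projection P"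
  shows "norm (P x) \<le> norm x"
proof (cases "P x = 0")
  case False
  have "norm (P x) * norm (P x) = inner (P x) x"
    by (simp add: orthogonal_projection_inner_self[OF assms] power2_eq_square)
  also have "\<dots> \<le> norm (P x) * norm x" by (rule norm_cauchy_schwarz)
  finally show ?thesis using False by simp
qed simp

section \<open>Schur's lemma\<close>

lemma symmetric_operator_to_effect:
  assumes C: "symmetric_operator C"
  obtains a b where "0 < a" "effect (\<lambda>x. a *\<^sub>R C x + b *\<^sub>R x)"
proof -
  obtain K where K: "0 < K" "\<And>x. norm (C x) \<le> norm x * K"
    using bounded_linear.pos_bounded[OF symmetric_operator_linear[OF C]] by blast
  have bd: "\<bar>inner (C x) x\<bar> \<le> K * inner x x" for x
  proof -
    have "\<bar>inner (C x) x\<bar> \<le> norm (C x) * norm x" by (rule Cauchy_Schwarz_ineq2)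
    also have "\<dots> \<le> norm x * K * norm x" by (intro mult_right_mono K) simp
    finally show ?thesis by (simp add: power2_norm_eq_inner[symmetric] power2_eq_square algebra_simps)
  qed
  define T where "T = (\<lambda>x. (1/(2*K)) *\<^sub>R C x + (1/2) *\<^sub>R x)"
  have sym: "symmetric_operator T" unfolding T_def
    by (rule symmetric_operator_add[OF symmetric_operator_scaleR[OF C] symmetric_operator_scaleR[OF symmetric_operator_id]])
  have "0 \<le> inner (T x) x" "0 \<le> inner (x - T x) x" for x
    using bd[of x] K(1) by (simp_all add: T_def inner_add_left inner_diff_left field_simps abs_le_iff)
  then have "effect T"
    using sym symmetric_operator_diff[OF symmetric_operator_id sym]
    by (simp add: effect_def positive_operator_def)
  then show ?thesis using that[of "1/(2*K)" "1/2"] K(1) by (simp add: T_def)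
qed

lemma symmetric_operator_eq_0:
  assumes C: "symmetric_operator C" and "\<And>x. inner (C x) x = 0"
  shows "C x = 0"
proof -
  note lin = bounded_linear.linear[OF symmetric_operator_linear[OF C]]
  have "inner (C (x + C x)) (x + C x) = 0" by (rule assms(2))
  then have "2 * inner (C x) (C x) = 0"
    by (simp add: linear_add[OF lin] inner_add_left inner_add_right assms(2) symmetric_operator_inner[OF C])
  then show ?thesis by simp
qed

text \<open>
  For each real \<open>l\<close> the functions \<open>max (t - l) 0\<close> and \<open>max (l - t) 0\<close> have product zero.  The kernel of the
  first one, evaluated at \<open>T\<close>, is a closed invariant subspace, so it is zero or everything; accordingly
  \<open>T \<ge> l\<close> or \<open>T \<le> l\<close>.  The supremum of the numbers of the first kind is the scalar.
\<close>

lemma schur_effect: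
  fixes P :: "'i \<Rightarrow> 'h::chilbert_space \<Rightarrow> 'h"
  assumes irr: "irreducible_family S P" and lin: "\<And>g. g \<in> S \<Longrightarrow> bounded_linear (P g)"
    and T: "effect T" and cx: "\<And>c x. T (c *\<^sub>C x) = c *\<^sub>C T x"
    and comm: "\<And>g x. g \<in> S \<Longrightarrow> P g (T x) = T (P g x)"
  shows "\<exists>k. \<forall>x. T x = k *\<^sub>R x"
proof (cases "\<exists>z::'h. z \<noteq> 0")
  case False
  then show ?thesis by (metis scaleR_zero_right)
next
  case True
  then obtain z :: 'h where z: "z \<noteq> 0" by blast
  note Tlin = effect_linear[OF T]
  have dich: "(\<forall>x. l * inner x x \<le> inner (T x) x) \<or> (\<forall>x. inner (T x) x \<le> l * inner x x)" for l
  proof -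
    define f where "f = (\<lambda>t. max (t - l) 0)"
    define g where "g = (\<lambda>t. max (l - t) 0)"
    have f: "continuous_on {0..1} f" and g: "continuous_on {0..1} g"
      by (auto simp: f_def g_def intro!: continuous_intros)
    define F where "F = continuous_calculus T f"
    define G where "G = continuous_calculus T g"
    have Flin: "bounded_linear F" unfolding F_def by (rule bounded_linear_continuous_calculus[OF T f])
    have FG: "F (G x) = 0" for x
    proof -
      have "F (G x) = continuous_calculus T (\<lambda>t. f t * g t) x"
        by (simp add: F_def G_def continuous_calculus_mult[OF T f g])
      also have "\<dots> = poly_operator 0 T x"
        by (rule continuous_calculus_poly[OF T]) (auto simp: f_def g_def max_def)
      finally show ?thesis by simp
    qed
    have diff: "F x - G x = T x - l *\<^sub>R x" for x
    proof -
      have "F x - G x = continuous_calculus T (\<lambda>t. f t - g t) x"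
        by (simp add: F_def G_def continuous_calculus_diff[OF T f g])
      also have "\<dots> = poly_operator [:-l, 1:] T x"
        by (rule continuous_calculus_poly[OF T]) (auto simp: f_def g_def max_def)
      finally show ?thesis by (simp add: poly_operator_pCons[OF Tlin] linear_0[OF Tlin])
    qed
    have Fpos: "0 \<le> inner (F x) x" and Gpos: "0 \<le> inner (G x) x" for x
      by (auto simp: F_def G_def f_def g_def intro!: continuous_calculus_nonneg[OF T] continuous_intros)
    define M where "M = {x. F x = 0}"
    have "complex_vector.subspace M"
      unfolding complex_vector.subspace_def M_def
      using linear_0[OF bounded_linear.linear[OF Flin]] linear_add[OF bounded_linear.linear[OF Flin]]
        continuous_calculus_commute[OF T f bounded_linear_scaleC] cx
      by (auto simp: F_def[symmetric]) (metis complex_vector.scale_zero_right)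
    moreover have "closed M"
      unfolding M_def using Flin
      by (intro closed_Collect_eq continuous_intros linear_continuous_on)
    moreover have "P h ` M \<subseteq> M" if "h \<in> S" for h
      using continuous_calculus_commute[OF T f lin[OF that] comm[OF that]]
        linear_0[OF bounded_linear.linear[OF lin[OF that]]]
      by (auto simp: M_def F_def) metis
    ultimately have "M = {0} \<or> M = UNIV" using irr unfolding irreducible_family_def by blast
    then show ?thesis
    proof
      assume "M = {0}"
      then have "G x = 0" for x using FG[of x] by (auto simp: M_def)
      then have "F x = T x - l *\<^sub>R x" for x using diff[of x] by simp
      then show ?thesis using Fpos by (simp add: inner_diff_left)
    next
      assume "M = UNIV"
      then have "F x = 0" for x by (auto simp: M_def)
      then have "G x = l *\<^sub>R x - T x" for x using diff[of x] by (simp add: algebra_simps)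
      then show ?thesis using Gpos by (simp add: inner_diff_left)
    qed
  qed
  define A where "A = {l. \<forall>x. l * inner x x \<le> inner (T x) x}"
  have zz: "0 < inner z z" using z by simp
  have "0 \<in> A" using T by (simp add: A_def effect_def positive_operator_def)
  have up: "l \<le> inner (T z) z / inner z z" if "l \<in> A" for l
    using that zz by (simp add: A_def field_simps)
  then have bdd: "bdd_above A" by (rule bdd_aboveI)
  define k where "k = Sup A"
  have le: "k * inner x x \<le> inner (T x) x" for x
  proof (cases "x = 0")
    case False
    then have xx: "0 < inner x x" by simp
    have "k \<le> inner (T x) x / inner x x"
      unfolding k_def
    proof (rule cSup_least)
      show "A \<noteq> {}" using \<open>0 \<in> A\<close> by blast
      show "l \<le> inner (T x) x / inner x x" if "l \<in> A" for l
        using that xx by (simp add: A_def field_simps)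
    qed
    then show ?thesis using xx by (simp add: field_simps)
  qed (simp add: linear_0[OF Tlin])
  have ge: "inner (T x) x \<le> k * inner x x" for x
  proof (rule field_le_epsilon)
    fix e :: real assume e: "0 < e"
    define d where "d = e / (inner x x + 1)"
    have xx: "0 < inner x x + 1" by (rule add_nonneg_pos) auto
    then have d: "0 < d" "d * inner x x \<le> e" using e by (auto simp: d_def field_simps)
    have "k + d \<notin> A" using cSup_upper[OF _ bdd, of "k + d"] d(1) by (auto simp: k_def)
    then have "inner (T x) x \<le> (k + d) * inner x x" using dich[of "k + d"] by (auto simp: A_def)
    then show "inner (T x) x \<le> k * inner x x + e" using d(2) by (simp add: algebra_simps)
  qed
  have "symmetric_operator (\<lambda>x. T x - k *\<^sub>R x)"
    by (rule symmetric_operator_diff[OF effect_symmetric[OF T] symmetric_operator_scaleR[OF symmetric_operator_id]])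
  then have "T x - k *\<^sub>R x = 0" for x
    by (rule symmetric_operator_eq_0) (use le ge in \<open>simp add: inner_diff_left order_antisym\<close>)
  then show ?thesis by (metis eq_iff_diff_eq_0)
qed

text \<open>
  An affine change of variable turns a symmetric operator into one with \<open>0 \<le> T \<le> 1\<close>.
\<close>

theorem schur:
  fixes P :: "'i \<Rightarrow> 'h::chilbert_space \<Rightarrow> 'h"
  assumes irr: "irreducible_family S P" and lin: "\<And>g. g \<in> S \<Longrightarrow> bounded_linear (P g)"
    and C: "symmetric_operator C" and cx: "\<And>c x. C (c *\<^sub>C x) = c *\<^sub>C C x"
    and comm: "\<And>g x. g \<in> S \<Longrightarrow> P g (C x) = C (P g x)"
  shows "\<exists>k. \<forall>x. C x = k *\<^sub>R x"
proof -
  obtain a b where ab: "0 < a" "effect (\<lambda>x. a *\<^sub>R C x + b *\<^sub>R x)"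
    by (rule symmetric_operator_to_effect[OF C])
  have "\<exists>k. \<forall>x. a *\<^sub>R C x + b *\<^sub>R x = k *\<^sub>R x"
  proof (rule schur_effect[OF irr lin ab(2)])
    show "a *\<^sub>R C (c *\<^sub>C x) + b *\<^sub>R c *\<^sub>C x = c *\<^sub>C (a *\<^sub>R C x + b *\<^sub>R x)" for c x
      by (simp add: cx scaleR_scaleC scaleC_add_right scaleC_scaleC mult.commute)
    show "P g (a *\<^sub>R C x + b *\<^sub>R x) = a *\<^sub>R C (P g x) + b *\<^sub>R P g x" if "g \<in> S" for g x
      using bounded_linear.linear[OF lin[OF that]] by (simp add: linear_add linear_scale comm[OF that])
  qed
  then obtain k where k: "\<And>x. a *\<^sub>R C x + b *\<^sub>R x = k *\<^sub>R x" by blast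
  have "C x = ((k - b) / a) *\<^sub>R x" for x
  proof -
    have "a *\<^sub>R C x = (k - b) *\<^sub>R x" using k[of x] by (simp add: algebra_simps)
    then have "(1/a) *\<^sub>R a *\<^sub>R C x = (1/a) *\<^sub>R (k - b) *\<^sub>R x" by simp
    then show ?thesis using ab(1) by simp
  qed
  then show ?thesis by blast
qed

section \<open>Reflections of the spectrum\<close>

text \<open>
  The operator \<open>(A - s)\<^sup>2\<close>.
\<close>

definition shifted_square :: "('h \<Rightarrow> 'h) \<Rightarrow> real \<Rightarrow> 'h \<Rightarrow> 'h::real_vector"
  where "shifted_square A s x = A (A x - s *\<^sub>R x) - s *\<^sub>R (A x - s *\<^sub>R x)"

definition eigenvalues :: "('h::real_vector \<Rightarrow> 'h) \<Rightarrow> real set"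
  where "eigenvalues A = {l. \<exists>x. x \<noteq> 0 \<and> A x = l *\<^sub>R x}"

text \<open>
  This collects what the pair of a one-parameter poset contributes to the analysis of \<open>A\<close>.  On an
  eigenspace away from \<open>s\<close>, the diagonal part of \<open>Q\<close> is a scalar \<open>a\<close> that depends only on the eigenvalue, and
  the remainder \<open>Q - a\<close> maps into the eigenspace at the reflected point.  At \<open>s\<close> itself the
  diagonal part need not be a scalar, since there \<open>Q\<close> may restrict to an arbitrary projection.
\<close>

definition reflecting_projection ::
  "('h \<Rightarrow> 'h) \<Rightarrow> real \<Rightarrow> ('h::complex_inner \<Rightarrow> 'h) \<Rightarrow> bool"
  where "reflecting_projection A s Q \<longleftrightarrow>
    orthogonal_projection Q \<and>
    (\<forall>x. Q (shifted_square A s x) = shifted_square A s (Q x)) \<and>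
    (\<forall>l. l \<noteq> s \<longrightarrow> (\<exists>a. \<forall>x. A x = l *\<^sub>R x \<longrightarrow>
      A (Q x - a *\<^sub>R x) = (2 * s - l) *\<^sub>R (Q x - a *\<^sub>R x)))"

text \<open>
  The quadratic form of \<open>(A - s)\<^sup>2\<close> at \<open>x\<close> is the squared norm of \<open>(A - s) x\<close>.
\<close>

lemma shifted_square_eq_0:
  assumes A: "symmetric_operator A" and "shifted_square A s x = 0"
  shows "A x = s *\<^sub>R x"
proof -
  have "symmetric_operator (\<lambda>x. A x - s *\<^sub>R x)"
    by (rule symmetric_operator_diff[OF A symmetric_operator_scaleR[OF symmetric_operator_id]])
  from symmetric_operator_inner[OF this, of "A x - s *\<^sub>R x" x]
  have "inner (A x - s *\<^sub>R x) (A x - s *\<^sub>R x) = inner (shifted_square A s x) x"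
    by (simp add: shifted_square_def)
  then show ?thesis using assms(2) by simp
qed

lemma reflecting_projection_fixes_center:
  assumes A: "symmetric_operator A" and Q: "reflecting_projection A s Q" and x: "A x = s *\<^sub>R x"
  shows "A (Q x) = s *\<^sub>R Q x"
proof (rule shifted_square_eq_0[OF A])
  have "orthogonal_projection Q" using Q by (simp add: reflecting_projection_def)
  note lin = bounded_linear.linear[OF orthogonal_projection_bounded_linear[OF this]]
  have "shifted_square A s x = 0"
    using bounded_linear.linear[OF symmetric_operator_linear[OF A]]
    by (simp add: shifted_square_def x linear_0)
  then have "Q (shifted_square A s x) = 0" by (simp add: linear_0[OF lin])
  then show "shifted_square A s (Q x) = 0" using Q by (simp add: reflecting_projection_def)
qed

text \<open>
  If \<open>l = s\<close> is not an eigenvalue, there is no eigenvector to consider and any \<open>a\<close> will do.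
\<close>

lemma reflecting_projection_coefficient:
  assumes A: "linear A" and Q: "reflecting_projection A s Q" and l: "l \<noteq> s \<or> s \<notin> eigenvalues A"
  shows "\<exists>a. \<forall>x. A x = l *\<^sub>R x \<longrightarrow> A (Q x - a *\<^sub>R x) = (2 * s - l) *\<^sub>R (Q x - a *\<^sub>R x)"
proof (cases "l = s")
  case True
  have "orthogonal_projection Q" using Q by (simp add: reflecting_projection_def)
  note lin = bounded_linear.linear[OF orthogonal_projection_bounded_linear[OF this]]
  have "x = 0" if "A x = l *\<^sub>R x" for x
    using that l True by (auto simp: eigenvalues_def)
  then show ?thesis using linear_0[OF A] linear_0[OF lin] by (metis diff_zero scaleR_zero_right)
next
  case False
  then show ?thesis using Q by (simp add: reflecting_projection_def)
qed

text \<open>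
  A function symmetric about \<open>s\<close> has the form \<open>F ((t - s)\<^sup>2)\<close> and is approximated by polynomials
  in \<open>(t - s)\<^sup>2\<close>, whose values at \<open>T\<close> commute with \<open>R\<close>.
\<close>

lemma continuous_calculus_even_commute:
  assumes T: "effect T" and R: "bounded_linear R"
    and comm: "\<And>x. R (shifted_square T s x) = shifted_square T s (R x)"
    and F: "continuous_on {0..M} F" and M: "\<And>t. t \<in> {0..1} \<Longrightarrow> (t - s)\<^sup>2 \<le> M"
  shows "R (continuous_calculus T (\<lambda>t. F ((t - s)\<^sup>2)) x) = continuous_calculus T (\<lambda>t. F ((t - s)\<^sup>2)) (R x)"
proof -
  note lin = effect_linear[OF T]
  obtain q where q: "uniform_limit {0..M} (\<lambda>n. poly (q n)) F sequentially"
    by (rule polynomial_approximation[OF F])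
  define z where "z = [:s * s, - (s + s), 1:]"
  have "poly z t = (t - s)\<^sup>2" for t by (simp add: z_def power2_eq_square algebra_simps)
  then have pz: "poly (pcompose (q n) z) t = poly (q n) ((t - s)\<^sup>2)" for n t
    by (simp add: poly_pcompose)
  have "uniform_limit {0..1} (\<lambda>n t. poly (pcompose (q n) z) t) (\<lambda>t. F ((t - s)\<^sup>2)) sequentially"
    unfolding pz using M by (intro uniform_limit_compose'[OF q]) auto
  then have q': "uniform_limit {0..1} (\<lambda>n. poly (pcompose (q n) z)) (\<lambda>t. F ((t - s)\<^sup>2)) sequentially"
    by simp
  have "poly_operator z T = shifted_square T s"
    by (rule ext, simp add: z_def shifted_square_def poly_operator_pCons[OF lin] linear_0[OF lin]
        linear_add[OF lin] linear_diff[OF lin] linear_scale[OF lin] algebra_simps,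
        simp flip: scaleR_add_left)
  moreover from this have "linear (shifted_square T s)"
    by (metis bounded_linear.linear bounded_linear_poly_operator effect_bounded_linear[OF T])
  ultimately have "R (poly_operator (pcompose (q n) z) T x) = poly_operator (pcompose (q n) z) T (R x)" for n x
    by (simp add: poly_operator_pcompose[OF lin] poly_operator_commute[of "shifted_square T s" R, OF _ bounded_linear.linear[OF R] comm])
  then show ?thesis by (rule continuous_calculus_commute_approx[OF T q' R])
qed

section \<open>Representations of one-parameter posets\<close>

text \<open>
  Each of the two parts of the poset carries its own portion of the character, so the weights are
  arbitrary positive numbers.
\<close>

locale weighted_representation =
  fixes T :: "'a::order set" and P :: "'a \<Rightarrow> 'h::chilbert_space \<Rightarrow> 'h" and w :: "'a \<Rightarrow> real"
  assumes finite_T: "finite T"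
    and projection: "g \<in> T \<Longrightarrow> orthogonal_projection (P g)"
    and monotone: "g \<in> T \<Longrightarrow> h \<in> T \<Longrightarrow> g < h \<Longrightarrow> P g \<circ> P h = P g"
    and weight_pos: "g \<in> T \<Longrightarrow> 0 < w g"
begin

definition A :: "'h \<Rightarrow> 'h"
  where "A x = (\<Sum>g\<in>T. w g *\<^sub>R P g x)"

lemma lin: "g \<in> T \<Longrightarrow> linear (P g)"
  by (simp add: bounded_linear.linear orthogonal_projection_bounded_linear projection)

lemma comp_right: "g \<in> T \<Longrightarrow> h \<in> T \<Longrightarrow> g \<le> h \<Longrightarrow> P g (P h x) = P g x"
  using monotone[of g h] projection[of g]
  by (cases "g = h") (auto simp: fun_eq_iff orthogonal_projection_idem order.strict_iff_order)

lemma comp_left: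
  assumes "g \<in> T" "h \<in> T" "g \<le> h"
  shows "P h (P g x) = P g x"
proof -
  note sym = symmetric_operator_inner[OF orthogonal_projection_symmetric[OF projection]]
  have "inner (P h (P g x)) y = inner (P g x) y" for y
    by (simp add: sym assms comp_right)
  then show ?thesis using vector_eq_rdot[of "P h (P g x)" "P g x"] by blast
qed

lemma comparable_commute: "g \<in> T \<Longrightarrow> h \<in> T \<Longrightarrow> g \<le> h \<or> h \<le> g \<Longrightarrow> P g (P h x) = P h (P g x)"
  by (auto simp: comp_left comp_right)

lemma symmetric_A: "symmetric_operator A"
proof -
  have "bounded_linear (\<lambda>x. \<Sum>g\<in>T. w g *\<^sub>R P g x)"
    by (intro bounded_linear_sum bounded_linear_const_scaleR orthogonal_projection_bounded_linear projection)
  moreover have "inner (A x) y = inner x (A y)" for x y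
    by (simp add: A_def inner_sum_left inner_sum_right
        symmetric_operator_inner[OF orthogonal_projection_symmetric[OF projection]])
  ultimately show ?thesis by (simp add: symmetric_operator_def A_def[abs_def])
qed

lemma linear_A: "linear A"
  by (rule bounded_linear.linear[OF symmetric_operator_linear[OF symmetric_A]])

lemma A_scaleC: "A (c *\<^sub>C x) = c *\<^sub>C A x"
  by (simp add: A_def orthogonal_projection_scaleC[OF projection] complex_vector.scale_sum_right
      scaleR_scaleC scaleC_scaleC mult.commute)

lemma inner_A: "inner (A x) x = (\<Sum>g\<in>T. w g * (norm (P g x))\<^sup>2)"
  by (simp add: A_def inner_sum_left orthogonal_projection_inner_self[OF projection])

lemma positive_A: "positive_operator A"
  by (auto simp: positive_operator_def symmetric_A inner_A less_imp_le[OF weight_pos] intro!: sum_nonneg)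

end

text \<open>
  All that is used about the block structure: outside one incomparable pair, every element is
  comparable with the whole poset.
\<close>

lemma unitarily_one_parameter_pair:
  assumes "unitarily_one_parameter T"
  obtains p q where "p \<in> T" "q \<in> T" "\<not> p \<le> q" "\<not> q \<le> p"
    "\<And>g h. g \<in> T - {p, q} \<Longrightarrow> h \<in> T \<Longrightarrow> g \<le> h \<or> h \<le> g"
proof -
  obtain m k and B :: "nat \<Rightarrow> 'a set" where k: "k \<in> {1..m}" and T: "T = (\<Union>i\<in>{1..m}. B i)"
    and lt: "\<And>i j x y. i \<in> {1..m} \<Longrightarrow> j \<in> {1..m} \<Longrightarrow> i < j \<Longrightarrow> x \<in> B i \<Longrightarrow> y \<in> B j \<Longrightarrow> x < y"
    and Bk: "\<exists>x y. B k = {x, y} \<and> \<not> x \<le> y \<and> \<not> y \<le> x"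
    and single: "\<And>i. i \<in> {1..m} - {k} \<Longrightarrow> \<exists>x. B i = {x}"
    using assms unfolding unitarily_one_parameter_def by metis
  obtain p q where pq: "B k = {p, q}" "\<not> p \<le> q" "\<not> q \<le> p" using Bk by blast
  have "g \<le> h \<or> h \<le> g" if gh: "g \<in> T - {p, q}" "h \<in> T" for g h
  proof -
    obtain i j where ij: "i \<in> {1..m}" "g \<in> B i" "j \<in> {1..m}" "h \<in> B j"
      using gh T by blast
    consider "i < j" | "j < i" | "i = j" by linarith
    then show ?thesis
    proof cases
      case 3
      then have "i \<in> {1..m} - {k}" using gh(1) ij pq(1) by auto
      then show ?thesis using single ij 3 by fastforce
    qed (use lt ij order.strict_implies_order in blast)+
  qed
  moreover have "p \<in> T" "q \<in> T" using T k pq(1) by auto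
  ultimately show ?thesis using that pq by blast
qed

locale one_parameter_representation = weighted_representation T P w
  for T :: "'a::order set" and P :: "'a \<Rightarrow> 'h::chilbert_space \<Rightarrow> 'h" and w :: "'a \<Rightarrow> real" +
  fixes p q :: 'a
  assumes p: "p \<in> T" and q: "q \<in> T" and incomparable: "\<not> p \<le> q" "\<not> q \<le> p"
    and comparable: "g \<in> T - {p, q} \<Longrightarrow> h \<in> T \<Longrightarrow> g \<le> h \<or> h \<le> g"
begin

definition above :: real
  where "above = (\<Sum>g\<in>{g \<in> T - {p, q}. p < g}. w g)"

lemma above_alt: "above = (\<Sum>g\<in>T - {p, q}. if p < g then w g else 0)"
  unfolding above_def using finite_T by (intro sum.inter_filter) auto

definition center :: real
  where "center = above + (w p + w q) / 2"

definition N :: "'h \<Rightarrow> 'h"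
  where "N x = (\<Sum>g\<in>T - {p, q}. w g *\<^sub>R P g x)"

lemma p_neq_q: "p \<noteq> q"
  using incomparable by auto

lemma chain_cases:
  assumes "g \<in> T - {p, q}"
  obtains "p < g" "q < g" | "g < p" "g < q" "\<not> p < g"
  using comparable[OF assms p] comparable[OF assms q] incomparable assms
  by (metis DiffE insertCI order.strict_iff_order order.trans order.asym)

lemma A_split: "A x = w p *\<^sub>R P p x + w q *\<^sub>R P q x + N x"
proof -
  have "A x = (\<Sum>g\<in>insert p (insert q (T - {p, q})). w g *\<^sub>R P g x)"
    unfolding A_def using p q by (intro sum.cong) auto
  then show ?thesis using finite_T p_neq_q by (simp add: N_def)
qed

lemma linear_N: "linear N"
  unfolding N_def[abs_def] by (intro linear_compose_sum ballI linear_compose_scale_right lin) auto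

lemma N_commute: "h \<in> T \<Longrightarrow> N (P h x) = P h (N x)"
  unfolding N_def by (simp add: linear_sum[OF lin] linear_scale[OF lin])
    (intro sum.cong refl arg_cong[of _ _ "scaleR _"] comparable_commute comparable, auto)

text \<open>
  A chain element below the pair annihilates the commutator of \<open>P p\<close> and \<open>P q\<close>, because its projection
  absorbs both factors; one above the pair fixes it.  So on the commutator the chain part of \<open>A\<close> acts as the
  total weight above the pair.
\<close>

lemma N_commutator:
  "N (P q (P p x) - P p (P q x)) = above *\<^sub>R (P q (P p x) - P p (P q x))"
proof -
  define y where "y = P q (P p x) - P p (P q x)"
  have "P g y = (if p < g then y else 0)" if "g \<in> T - {p, q}" for g
  proof -
    have g: "g \<in> T" using that by simp
    from that show ?thesis
      by (rule chain_cases)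
        (simp_all add: y_def linear_diff[OF lin[OF g]] comp_left comp_right p q g less_imp_le)
  qed
  then have "N y = (\<Sum>g\<in>T - {p, q}. (if p < g then w g else 0) *\<^sub>R y)"
    unfolding N_def by (intro sum.cong) auto
  also have "\<dots> = above *\<^sub>R y"
    by (simp only: above_alt scaleR_sum_left)
  finally show ?thesis by (simp add: y_def)
qed

definition V :: "'h \<Rightarrow> 'h"
  where "V x = A x - center *\<^sub>R x"

text \<open>
  Let \<open>y\<close> be the commutator of \<open>P q\<close> and \<open>P p\<close>.  The commutator of \<open>V\<close> with \<open>P p\<close> is \<open>w q *\<^sub>R y\<close>, and \<open>y\<close>
  anticommutes with \<open>V\<close> exactly because \<open>V\<close> is centered at \<open>above + (w p + w q) / 2\<close>.
\<close>

lemma V_square_commute_pair: "P p (V (V x)) = V (V (P p x))"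
proof -
  note [simp] = linear_add[OF lin] linear_diff[OF lin] linear_scale[OF lin]
    linear_add[OF linear_N] linear_diff[OF linear_N] linear_scale[OF linear_N]
    p q comp_left comp_right
  define y where "y = (\<lambda>x. P q (P p x) - P p (P q x))"
  have VP: "V (P p x) = P p (V x) + w q *\<^sub>R y x" for x
    by (simp add: V_def A_split y_def N_commute algebra_simps)
  have Vlin: "V (u + r *\<^sub>R v) = V u + r *\<^sub>R V v" for u v r
    by (simp add: V_def A_split algebra_simps)
  have "V (y x) + y (V x) = 0"
  proof -
    have 1: "V (y x) = w p *\<^sub>R P p (y x) + w q *\<^sub>R P q (y x) + (above - center) *\<^sub>R y x"
      using N_commutator[of x] by (simp add: V_def A_split y_def algebra_simps)
    have 2: "y (V x) = w p *\<^sub>R y (P p x) + w q *\<^sub>R y (P q x) + (above - center) *\<^sub>R y x"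
      using N_commutator[of x] by (simp add: V_def A_split y_def N_commute algebra_simps)
    have "P p (y x) + y (P p x) = y x" "P q (y x) + y (P q x) = y x"
      by (simp_all add: y_def)
    then have 3: "w p *\<^sub>R P p (y x) + w p *\<^sub>R y (P p x) = w p *\<^sub>R y x"
      "w q *\<^sub>R P q (y x) + w q *\<^sub>R y (P q x) = w q *\<^sub>R y x"
      by (simp_all flip: scaleR_add_right)
    have "V (y x) + y (V x) = (w p *\<^sub>R P p (y x) + w p *\<^sub>R y (P p x))
        + (w q *\<^sub>R P q (y x) + w q *\<^sub>R y (P q x)) + 2 *\<^sub>R (above - center) *\<^sub>R y x"
      unfolding 1 2 scaleR_2 by (simp only: add_ac)
    also have "\<dots> = 0"
      unfolding 3 by (simp add: center_def flip: scaleR_add_left)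
    finally show ?thesis .
  qed
  then have "w q *\<^sub>R V (y x) + w q *\<^sub>R y (V x) = 0" by (simp flip: scaleR_add_right)
  moreover have "V (V (P p x)) = P p (V (V x)) + (w q *\<^sub>R V (y x) + w q *\<^sub>R y (V x))"
    unfolding VP Vlin by (simp only: add_ac)
  ultimately show ?thesis by simp
qed

text \<open>
  Let \<open>t\<close> be the total weight of the elements \<open>h \<ge> g\<close>.  On the range of \<open>P g\<close> all projections above \<open>g\<close> are the
  identity, so \<open>A \<ge> t\<close> there; on its kernel all projections up to \<open>g\<close> vanish, so \<open>A \<le> t - w g\<close>.
  As \<open>w g > 0\<close>, no eigenvalue is compatible with both, and since \<open>P g\<close> commutes with \<open>A\<close> an
  eigenvector cannot have components in both.
\<close>

lemma eigenvector_chain: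
  assumes x: "A x = l *\<^sub>R x" and g: "g \<in> T - {p, q}"
  shows "P g x = (if (\<Sum>h\<in>{h \<in> T. g \<le> h}. w h) \<le> l then x else 0)"
proof -
  define t where "t = (\<Sum>h\<in>{h \<in> T. g \<le> h}. w h)"
  have gT: "g \<in> T" using g by simp
  have comm: "A (P g x) = P g (A x)" for x
    unfolding A_def using gT
    by (simp add: linear_sum[OF lin] linear_scale[OF lin])
      (intro sum.cong refl arg_cong[of _ _ "scaleR _"] comparable_commute, use comparable[OF g] in auto)
  define y where "y = P g x"
  define z where "z = x - P g x"
  have Ay: "A y = l *\<^sub>R y" by (simp add: y_def comm x linear_scale[OF lin[OF gT]])
  then have Az: "A z = l *\<^sub>R z" by (simp add: z_def y_def linear_diff[OF linear_A] x algebra_simps)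
  have "t * (norm y)\<^sup>2 \<le> l * (norm y)\<^sup>2"
  proof -
    have "t * (norm y)\<^sup>2 = (\<Sum>h\<in>{h \<in> T. g \<le> h}. w h * (norm (P h y))\<^sup>2)"
      unfolding t_def sum_distrib_right
      by (intro sum.cong) (auto simp: y_def comp_left gT)
    also have "\<dots> \<le> (\<Sum>h\<in>T. w h * (norm (P h y))\<^sup>2)"
      using finite_T by (intro sum_mono2 mult_nonneg_nonneg) (auto intro: less_imp_le weight_pos)
    also have "\<dots> = inner (A y) y" by (rule inner_A[symmetric])
    also have "\<dots> = l * (norm y)\<^sup>2" by (simp add: Ay power2_norm_eq_inner)
    finally show ?thesis .
  qed
  then have 1: "t \<le> l \<or> y = 0" by (auto simp: mult_le_cancel_right)
  have "l * (norm z)\<^sup>2 \<le> (t - w g) * (norm z)\<^sup>2"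
  proof -
    have "P h z = 0" if "h \<in> T" "h \<le> g" for h
      using that gT by (simp add: z_def linear_diff[OF lin] comp_right)
    then have "(\<Sum>h\<in>T. w h * (norm (P h z))\<^sup>2) = (\<Sum>h\<in>{h \<in> T. \<not> h \<le> g}. w h * (norm (P h z))\<^sup>2)"
      using finite_T by (intro sum.mono_neutral_right) auto
    moreover have "l * (norm z)\<^sup>2 = inner (A z) z" by (simp add: Az power2_norm_eq_inner)
    ultimately have "l * (norm z)\<^sup>2 = (\<Sum>h\<in>{h \<in> T. \<not> h \<le> g}. w h * (norm (P h z))\<^sup>2)"
      by (simp add: inner_A)
    also have "\<dots> \<le> (\<Sum>h\<in>{h \<in> T. \<not> h \<le> g}. w h * (norm z)\<^sup>2)"
      using weight_pos projection
      by (intro sum_mono mult_left_mono power_mono orthogonal_projection_norm_le) (auto intro: less_imp_le)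
    also have "\<dots> = (\<Sum>h\<in>{h \<in> T. g \<le> h} - {g}. w h) * (norm z)\<^sup>2"
      unfolding sum_distrib_right using comparable[OF g] by (intro sum.cong) auto
    also have "(\<Sum>h\<in>{h \<in> T. g \<le> h} - {g}. w h) = t - w g"
      unfolding t_def using finite_T gT by (subst sum_diff1) auto
    finally show ?thesis .
  qed
  then have "l \<le> t - w g \<or> z = 0" by (auto simp: mult_le_cancel_right)
  then have 2: "l < t \<or> z = 0" using weight_pos[OF gT] by linarith
  show ?thesis using 1 2 by (auto simp: y_def z_def t_def)
qed

lemma N_eigenvector:
  obtains m where "\<And>x. A x = l *\<^sub>R x \<Longrightarrow> N x = m *\<^sub>R x"
proof -
  have "N x = (\<Sum>g\<in>T - {p, q}. if (\<Sum>h\<in>{h \<in> T. g \<le> h}. w h) \<le> l then w g else 0) *\<^sub>R x"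
    if "A x = l *\<^sub>R x" for x
    unfolding N_def scaleR_sum_left by (intro sum.cong refl) (auto simp: eigenvector_chain[OF that])
  then show ?thesis by (rule that)
qed

text \<open>
  The chain part of \<open>A\<close> is a scalar on \<open>x\<close>, so the eigenvalue equation expresses \<open>P q x\<close> by \<open>x\<close> and \<open>P p x\<close>.
\<close>

lemma eigenvector_span:
  assumes x: "A x = l *\<^sub>R x" and g: "g \<in> T"
  shows "P g x \<in> complex_vector.span {x, P p x}"
proof -
  obtain m where m: "N x = m *\<^sub>R x" using N_eigenvector x by metis
  have "w q *\<^sub>R P q x = (l - m) *\<^sub>R x - w p *\<^sub>R P p x"
    using A_split[of x] x m by (simp add: algebra_simps)
  then have "(1 / w q) *\<^sub>R w q *\<^sub>R P q x = (1 / w q) *\<^sub>R ((l - m) *\<^sub>R x - w p *\<^sub>R P p x)"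
    by simp
  then have "P q x = (1 / w q) *\<^sub>R ((l - m) *\<^sub>R x - w p *\<^sub>R P p x)"
    using weight_pos[OF q] by simp
  then have "P q x \<in> complex_vector.span {x, P p x}"
    by (simp add: scaleR_scaleC complex_vector.span_scale complex_vector.span_diff complex_vector.span_base)
  moreover have "P g x \<in> complex_vector.span {x, P p x}" if "g \<in> T - {p, q}"
    using eigenvector_chain[OF x that] by (simp add: complex_vector.span_base complex_vector.span_zero)
  moreover have "P p x \<in> complex_vector.span {x, P p x}" by (simp add: complex_vector.span_base)
  ultimately show ?thesis using g by (cases "g = p"; cases "g = q") simp_all
qed

text \<open>
  By \<open>eigenvector_chain\<close> the eigenvalue alone decides which chain projections are \<open>1\<close>.  If some
  chain element below the pair is \<open>1\<close>, or some chain element above it is \<open>0\<close>, then \<open>P p x\<close> is \<open>x\<close> or \<open>0\<close>.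
  Otherwise the chain part of \<open>A\<close> acts on \<open>x\<close> as the total weight above the pair, so that
  \<open>w p *\<^sub>R P p x + w q *\<^sub>R P q x\<close> is a multiple of \<open>x\<close>.  Applying \<open>P q\<close> to this equation computes
  \<open>P q (P p x)\<close>, and then \<open>A (P p x)\<close> as a combination of \<open>x\<close> and \<open>P p x\<close>.  The span of
  \<open>x\<close> and \<open>P p x\<close> is diagonalised by \<open>x\<close> and \<open>P p x - a *\<^sub>R x\<close>.
\<close>

lemma eigenvector_reflection:
  assumes l: "l \<noteq> center"
  shows "\<exists>a. \<forall>x. A x = l *\<^sub>R x \<longrightarrow> A (P p x - a *\<^sub>R x) = (2 * center - l) *\<^sub>R (P p x - a *\<^sub>R x)"
proof -
  let ?t = "\<lambda>g. \<Sum>h\<in>{h \<in> T. g \<le> h}. w h"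
  consider g where "g \<in> T - {p, q}" "g < p" "?t g \<le> l" | g where "g \<in> T - {p, q}" "p < g" "\<not> ?t g \<le> l"
    | "\<And>g. g \<in> T - {p, q} \<Longrightarrow> g < p \<Longrightarrow> \<not> ?t g \<le> l" "\<And>g. g \<in> T - {p, q} \<Longrightarrow> p < g \<Longrightarrow> ?t g \<le> l"
    by blast
  then show ?thesis
  proof cases
    case 1
    then have "P p x = x" if "A x = l *\<^sub>R x" for x
      using eigenvector_chain[OF that] comp_left[of g p x] p by simp
    then have "P p x - 1 *\<^sub>R x = 0" if "A x = l *\<^sub>R x" for x using that by simp
    then show ?thesis using linear_0[OF linear_A] by (metis scaleR_zero_right)
  next
    case 2
    then have "P p x = 0" if "A x = l *\<^sub>R x" for x
      using eigenvector_chain[OF that 2(1)] comp_right[of p g x] p by (simp add: linear_0[OF lin])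
    then have "P p x - 0 *\<^sub>R x = 0" if "A x = l *\<^sub>R x" for x using that by simp
    then show ?thesis using linear_0[OF linear_A] by (metis scaleR_zero_right)
  next
    case 3
    define n where "n = l - above"
    \<comment> \<open>\<open>A (P p x) = (2 * center - l) *\<^sub>R P p x + k *\<^sub>R x\<close>, and \<open>a\<close> removes the term in \<open>x\<close>\<close>
    define k where "k = n * (n - w q) / w p"
    define a where "a = k / (2 * l - 2 * center)"
    have "A (P p x - a *\<^sub>R x) = (2 * center - l) *\<^sub>R (P p x - a *\<^sub>R x)" if x: "A x = l *\<^sub>R x" for x
    proof -
      have N: "N x = above *\<^sub>R x"
      proof -
        have "N x = (\<Sum>g\<in>T - {p, q}. (if p < g then w g else 0) *\<^sub>R x)"
          unfolding N_def
        proof (rule sum.cong[OF refl])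
          fix g assume g: "g \<in> T - {p, q}"
          then show "w g *\<^sub>R P g x = (if p < g then w g else 0) *\<^sub>R x"
            by (cases rule: chain_cases) (use 3 g in \<open>auto simp: eigenvector_chain[OF x g]\<close>)
        qed
        also have "\<dots> = above *\<^sub>R x"
          by (simp only: above_alt scaleR_sum_left)
        finally show ?thesis .
      qed
      have 1: "w q *\<^sub>R P q x = n *\<^sub>R x - w p *\<^sub>R P p x"
        using A_split[of x] x N by (simp add: n_def algebra_simps)
      have "P q (w q *\<^sub>R P q x) = P q (n *\<^sub>R x - w p *\<^sub>R P p x)" by (simp add: 1)
      then have "w p *\<^sub>R P q (P p x) = (n - w q) *\<^sub>R P q x"
        by (simp add: linear_scale[OF lin] linear_diff[OF lin] q comp_left algebra_simps)
      then have "(w q / w p) *\<^sub>R w p *\<^sub>R P q (P p x) = (w q / w p) *\<^sub>R (n - w q) *\<^sub>R P q x" by simp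
      then have "w q *\<^sub>R P q (P p x) = ((n - w q) / w p) *\<^sub>R w q *\<^sub>R P q x"
        using weight_pos[OF p] by (simp add: mult.commute)
      also have "\<dots> = k *\<^sub>R x - (n - w q) *\<^sub>R P p x"
        using weight_pos[OF p] by (simp add: 1 k_def scaleR_diff_right mult.commute)
      finally have 2: "w q *\<^sub>R P q (P p x) = k *\<^sub>R x - (n - w q) *\<^sub>R P p x" .
      have "A (P p x) = w p *\<^sub>R P p x + w q *\<^sub>R P q (P p x) + above *\<^sub>R P p x"
        by (simp add: A_split p comp_left N_commute N linear_scale[OF lin])
      also have "\<dots> = (w p + above - (n - w q)) *\<^sub>R P p x + k *\<^sub>R x"
        unfolding 2 by (simp add: algebra_simps)
      also have "w p + above - (n - w q) = 2 * center - l" by (simp add: center_def n_def)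
      finally have AP: "A (P p x) = (2 * center - l) *\<^sub>R P p x + k *\<^sub>R x" .
      have "k = a * (2 * l - 2 * center)" using l by (simp add: a_def)
      then have "k - a * l = - (a * (2 * center - l))" by (simp add: algebra_simps)
      moreover have "A (P p x - a *\<^sub>R x) = (2 * center - l) *\<^sub>R P p x + (k - a * l) *\<^sub>R x"
        by (simp add: linear_diff[OF linear_A] linear_scale[OF linear_A] AP x algebra_simps)
      ultimately show ?thesis by (simp only: scaleR_diff_right) (simp add: mult.commute)
    qed
    then show ?thesis by blast
  qed
qed

lemma swap: "one_parameter_representation T P w q p"
  using p q incomparable comparable by unfold_locales auto

lemma center_swap: "one_parameter_representation.center T w q p = center"
proof -
  interpret s: one_parameter_representation T P w q p by (rule swap)
  have "{g \<in> T - {q, p}. q < g} = {g \<in> T - {p, q}. p < g}"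
    using chain_cases by (auto dest: order.asym)
  then show ?thesis by (simp add: center_def s.center_def above_def s.above_def)
qed

lemma V_square_commute:
  assumes h: "h \<in> T"
  shows "P h (V (V x)) = V (V (P h x))"
proof -
  consider "h = p" | "h = q" | "h \<in> T - {p, q}" using h by blast
  then show ?thesis
  proof cases
    case 1
    then show ?thesis by (simp add: V_square_commute_pair)
  next
    case 2
    interpret s: one_parameter_representation T P w q p by (rule swap)
    have "s.V x = V x" for x by (simp add: s.V_def V_def center_swap)
    then show ?thesis using 2 s.V_square_commute_pair[of x] by simp
  next
    case 3
    have "A (P h x) = P h (A x)" for x
      unfolding A_def using h
      by (simp add: linear_sum[OF lin] linear_scale[OF lin])
        (intro sum.cong refl arg_cong[of _ _ "scaleR _"] comparable_commute, use comparable[OF 3] in auto)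
    then show ?thesis by (simp add: V_def linear_diff[OF lin[OF h]] linear_scale[OF lin[OF h]]
        linear_diff[OF linear_A] linear_scale[OF linear_A])
  qed
qed

lemma reflecting_projection_A: "reflecting_projection A center (P p)"
  using V_square_commute[OF p] eigenvector_reflection
  by (simp add: reflecting_projection_def projection[OF p] shifted_square_def V_def)

lemma shifted_square_commute: "g \<in> T \<Longrightarrow> P g (shifted_square A center x) = shifted_square A center (P g x)"
  using V_square_commute by (simp add: shifted_square_def V_def)

end

lemma shifted_square_complement:
  assumes "linear A" "\<And>x. B x = x - A x"
  shows "shifted_square A (1 - s) x = shifted_square B s x"
  by (simp add: shifted_square_def assms(2) linear_diff[OF assms(1)] linear_scale[OF assms(1)] algebra_simps)

text \<open>
  Eigenvectors of \<open>B = 1 - A\<close> at \<open>1 - l\<close> are eigenvectors of \<open>A\<close> at \<open>l\<close>, so a center \<open>s\<close> for \<open>B\<close> becomes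
  the center \<open>1 - s\<close> for \<open>A\<close>.
\<close>

lemma reflecting_projection_complement:
  assumes A: "linear A" and B: "\<And>x. B x = x - A x" and Q: "reflecting_projection B s Q"
  shows "reflecting_projection A (1 - s) Q"
proof -
  have "\<exists>a. \<forall>x. A x = l *\<^sub>R x \<longrightarrow> A (Q x - a *\<^sub>R x) = (2 * (1 - s) - l) *\<^sub>R (Q x - a *\<^sub>R x)"
    if "l \<noteq> 1 - s" for l
  proof -
    have "1 - l \<noteq> s" using that by auto
    then obtain a where a: "\<And>x. B x = (1 - l) *\<^sub>R x \<Longrightarrow>
        B (Q x - a *\<^sub>R x) = (2 * s - (1 - l)) *\<^sub>R (Q x - a *\<^sub>R x)"
      using Q unfolding reflecting_projection_def by blast
    have "A (Q x - a *\<^sub>R x) = (2 * (1 - s) - l) *\<^sub>R (Q x - a *\<^sub>R x)" if "A x = l *\<^sub>R x" for x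
    proof -
      define y where "y = Q x - a *\<^sub>R x"
      have "B x = (1 - l) *\<^sub>R x" by (simp add: B that algebra_simps)
      then have "B y = (2 * s - (1 - l)) *\<^sub>R y" unfolding y_def by (rule a)
      then have "A y = y - (2 * s - (1 - l)) *\<^sub>R y" using B[of y] by (simp add: algebra_simps)
      also have "\<dots> = (1 - (2 * s - (1 - l))) *\<^sub>R y" by (simp only: scaleR_diff_left scaleR_one)
      finally show ?thesis by (simp add: y_def)
    qed
    then show ?thesis by blast
  qed
  then show ?thesis
    using Q by (simp add: reflecting_projection_def shifted_square_complement[OF A B])
qed

section \<open>Eigenvalues in the case of two distinct centers\<close>

lemma finite_cos_level_set:
  assumes d: "d \<noteq> 0"
  shows "finite {t \<in> {0..1::real}. cos (pi * (t - s) / d) = k}"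
proof (cases "\<exists>y. cos y = k")
  case False
  then have "{t \<in> {0..1::real}. cos (pi * (t - s) / d) = k} = {}" by auto
  then show ?thesis by (simp only: finite.emptyI)
next
  case True
  then obtain y where y: "k = cos y" by blast
  define N where "N = \<lceil>\<bar>y\<bar> + pi * (1 + \<bar>s\<bar>) / \<bar>d\<bar>\<rceil>"
  define h where "h = (\<lambda>(e, n). d * (e * y + 2 * of_int n * pi) / pi + s)"
  have "{t \<in> {0..1}. cos (pi * (t - s) / d) = k} \<subseteq> h ` ({-1, 1} \<times> {-N..N})"
  proof
    fix t assume "t \<in> {t \<in> {0..1}. cos (pi * (t - s) / d) = k}"
    then have t: "0 \<le> t" "t \<le> 1" "cos (pi * (t - s) / d) = cos y" by (auto simp: y)
    obtain n where "n \<in> \<int>" and "pi * (t - s) / d = y + 2 * n * pi \<or> pi * (t - s) / d = - y + 2 * n * pi"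
      using t(3) unfolding cos_eq by blast
    then obtain m :: int where "pi * (t - s) / d = 1 * y + 2 * of_int m * pi \<or> pi * (t - s) / d = -1 * y + 2 * of_int m * pi"
      by (auto elim!: Ints_cases)
    then obtain e :: real where e: "e \<in> {-1, 1}" and m: "pi * (t - s) / d = e * y + 2 * of_int m * pi"
      by blast
    have "\<bar>pi * (t - s) / d\<bar> \<le> pi * (1 + \<bar>s\<bar>) / \<bar>d\<bar>"
      using t(1,2) by (simp add: abs_mult divide_right_mono)
    moreover have "\<bar>of_int m\<bar> \<le> \<bar>2 * of_int m * pi\<bar>"
      using mult_left_mono[of 1 "2 * pi" "\<bar>of_int m\<bar>"] pi_gt3 by (simp add: abs_mult mult_ac)
    moreover have "\<bar>e * y\<bar> = \<bar>y\<bar>" using e by (auto simp: abs_mult)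
    ultimately have "\<bar>of_int m\<bar> \<le> \<bar>y\<bar> + pi * (1 + \<bar>s\<bar>) / \<bar>d\<bar>"
      using m by linarith
    then have "\<bar>m\<bar> \<le> N" unfolding N_def by linarith
    moreover have "t = h (e, m)"
      using m[symmetric] d by (simp add: h_def)
    ultimately show "t \<in> h ` ({-1, 1} \<times> {-N..N})" using e by (auto simp: abs_le_iff)
  qed
  then show ?thesis by (rule finite_subset) simp
qed

text \<open>
  The function \<open>c(t) = cos (pi * (t - s) / (s' - s))\<close> is even about \<open>s\<close>, and also about \<open>s'\<close> because a shift
  by \<open>s' - s\<close> changes its sign.  So \<open>c(A)\<close> commutes with all \<open>P g\<close> and is a scalar \<open>k\<close>.  The
  polynomial with simple roots at the finitely many points of the level set \<open>c = k\<close> annihilates \<open>A\<close>.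
\<close>

lemma two_centers_finite_eigenvalues:
  fixes P :: "'i \<Rightarrow> 'h::chilbert_space \<Rightarrow> 'h"
  assumes irr: "irreducible_family S P" and lin: "\<And>g. g \<in> S \<Longrightarrow> bounded_linear (P g)"
    and A: "effect A" and Ac: "\<And>c x. A (c *\<^sub>C x) = c *\<^sub>C A x" and ne: "s \<noteq> s'"
    and comm: "\<And>g. g \<in> S \<Longrightarrow> (\<forall>x. P g (shifted_square A s x) = shifted_square A s (P g x)) \<or>
      (\<forall>x. P g (shifted_square A s' x) = shifted_square A s' (P g x))"
    and z: "(z :: 'h) \<noteq> 0"
  shows "finite (eigenvalues A) \<and> eigenvalues A \<noteq> {}"
proof -
  define d where "d = s' - s"
  have d: "d \<noteq> 0" using ne by (simp add: d_def)
  define c where "c = (\<lambda>t. cos (pi * (t - s) / d))"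
  define F where "F = (\<lambda>u. cos (pi * sqrt u / d))"
  have cont: "continuous_on X c" "continuous_on X F" "continuous_on X (\<lambda>u. - F u)" for X
    using d by (auto simp: c_def F_def intro!: continuous_intros)
  have even: "cos (pi * \<bar>t\<bar> / d) = cos (pi * t / d)" for t
    by (cases "0 \<le> t") auto
  have c1: "c = (\<lambda>t. F ((t - s)\<^sup>2))"
    by (rule ext) (simp add: c_def F_def even)
  have c2: "c = (\<lambda>t. - F ((t - s')\<^sup>2))"
  proof
    fix t
    have "pi * (t - s) / d = pi * (t - s') / d + pi" using d by (simp add: d_def field_simps)
    then show "c t = - F ((t - s')\<^sup>2)" by (simp add: c_def F_def even)
  qed
  have bound: "(t - r)\<^sup>2 \<le> (1 + \<bar>r\<bar>)\<^sup>2" if "t \<in> {0..1}" for t r :: real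
    using that by (intro abs_le_square_iff[THEN iffD1]) auto
  have cc: "R (continuous_calculus A c x) = continuous_calculus A c (R x)"
    if "bounded_linear R" "(\<forall>x. R (shifted_square A s x) = shifted_square A s (R x)) \<or>
      (\<forall>x. R (shifted_square A s' x) = shifted_square A s' (R x))" for R x
    using that(2)
  proof
    assume "\<forall>x. R (shifted_square A s x) = shifted_square A s (R x)"
    then show ?thesis
      unfolding c1 by (intro continuous_calculus_even_commute[OF A that(1) _ cont(2) bound]) auto
  next
    assume "\<forall>x. R (shifted_square A s' x) = shifted_square A s' (R x)"
    then show ?thesis
      unfolding c2 by (intro continuous_calculus_even_commute[OF A that(1) _ cont(3) bound]) auto
  qed
  have "\<exists>k. \<forall>x. continuous_calculus A c x = k *\<^sub>R x"
  proof (rule schur[OF irr lin])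
    show "symmetric_operator (continuous_calculus A c)"
      by (rule symmetric_continuous_calculus[OF A cont(1)])
    show "continuous_calculus A c (a *\<^sub>C x) = a *\<^sub>C continuous_calculus A c x" for a x
      by (rule continuous_calculus_commute[OF A cont(1) bounded_linear_scaleC, symmetric]) (simp add: Ac)
    show "P g (continuous_calculus A c x) = continuous_calculus A c (P g x)" if "g \<in> S" for g x
      by (rule cc[OF lin[OF that] comm[OF that]])
  qed
  then obtain k where k: "\<And>x. continuous_calculus A c x = k *\<^sub>R x" by blast
  define Z where "Z = {t \<in> {0..1}. c t = k}"
  have Z: "finite Z" unfolding Z_def c_def by (rule finite_cos_level_set[OF d])
  define p where "p = (\<Prod>r\<in>Z. [:-r, 1:])"
  have root: "poly p t = 0 \<longleftrightarrow> t \<in> Z" for t using Z by (auto simp: p_def poly_prod)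
  have null: "poly_operator p A x = 0" for x
    by (rule level_set_poly_operator[OF A cont(1) k]) (simp add: root Z_def)
  have "eigenvalues A \<subseteq> Z"
    using poly_operator_eigenvector[OF effect_linear[OF A], of _ _ p]
    by (auto simp: eigenvalues_def null root)
  moreover have "\<exists>r\<in>Z. \<exists>y. y \<noteq> 0 \<and> A y = r *\<^sub>R y"
    using eigenvector_of_poly_root[OF Z effect_linear[OF A] z] null by (simp add: p_def)
  ultimately show ?thesis using finite_subset[OF _ Z] by (auto simp: eigenvalues_def)
qed

section \<open>Finite systems of eigenvectors: distinct centers\<close>

text \<open>
  The span of such a set is invariant under the two projections.  Since its elements are eigenvectors of
  \<open>A\<close>, \<open>eigenvector_span\<close> makes it invariant under the whole representation.
\<close>

definition eigenvector_system ::
  "('h \<Rightarrow> 'h) \<Rightarrow> ('h \<Rightarrow> 'h) \<Rightarrow> ('h \<Rightarrow> 'h) \<Rightarrow> 'h::complex_inner set \<Rightarrow> bool"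
  where "eigenvector_system A Q Q' F \<longleftrightarrow> finite F \<and>
    (\<forall>x\<in>F. (\<exists>l. A x = l *\<^sub>R x) \<and> Q x \<in> complex_vector.span F \<and> Q' x \<in> complex_vector.span F)"

lemma eigenvector_system_swap: "eigenvector_system A Q' Q F \<Longrightarrow> eigenvector_system A Q Q' F"
  by (auto simp: eigenvector_system_def)

text \<open>
  Starting with an eigenvector \<open>x0\<close> that \<open>Q\<close> maps to a multiple of itself, apply in turn the off-diagonal
  parts of \<open>Q'\<close>, \<open>Q\<close>, \<open>Q'\<close>, and so on.  Each of these parts maps back to a multiple of the previous vector,
  since a projection is idempotent, so the span of the ray is invariant.  The eigenvalues
  along the ray drift away by \<open>2 * (s' - s)\<close> in every second step, so only finitely many vectors are
  nonzero.  The last two hypotheses ensure that no nonzero vector of the ray belongs to the center of the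
  projection that is applied to it.
\<close>

lemma reflection_ray:
  assumes A: "linear A" and fin: "finite (eigenvalues A)"
    and Q: "reflecting_projection A s Q" and Q': "reflecting_projection A s' Q'" and ne: "s \<noteq> s'"
    and x0: "A x0 = l *\<^sub>R x0" "Q x0 = b *\<^sub>R x0"
    and even: "\<And>k::nat. l - 2 * (s' - s) * real k \<noteq> s' \<or> s' \<notin> eigenvalues A"
    and odd: "\<And>k::nat. 2 * s' - l + 2 * (s' - s) * real k \<noteq> s \<or> s \<notin> eigenvalues A"
  shows "\<exists>F. eigenvector_system A Q Q' F \<and> x0 \<in> F"
proof -
  define R where "R = (\<lambda>n::nat. if even n then Q' else Q)"
  define c where "c = (\<lambda>n::nat. if even n then s' else s)"
  define v where "v = (\<lambda>n::nat. if even n then l - 2 * (s' - s) * real (n div 2)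
    else 2 * s' - l + 2 * (s' - s) * real (n div 2))"
  have R: "reflecting_projection A (c n) (R n)" for n
    using Q Q' by (simp add: R_def c_def)
  have proj: "orthogonal_projection (R n)" for n
    using R[of n] by (simp add: reflecting_projection_def)
  note Rlin = bounded_linear.linear[OF orthogonal_projection_bounded_linear[OF proj]]
  have step: "2 * c n - v n = v (Suc n)" for n
    by (cases "even n") (auto simp: c_def v_def algebra_simps elim!: evenE oddE)
  have "v n \<noteq> c n \<or> c n \<notin> eigenvalues A" for n
    using even[of "n div 2"] odd[of "n div 2"] by (simp add: v_def c_def)
  from reflecting_projection_coefficient[OF A R this]
  have "\<exists>a. \<forall>n x. A x = v n *\<^sub>R x \<longrightarrow> A (R n x - a n *\<^sub>R x) = (2 * c n - v n) *\<^sub>R (R n x - a n *\<^sub>R x)"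
    by (intro choice allI)
  then obtain a where a: "\<And>n x. A x = v n *\<^sub>R x \<Longrightarrow>
      A (R n x - a n *\<^sub>R x) = v (Suc n) *\<^sub>R (R n x - a n *\<^sub>R x)"
    unfolding step by blast
  define X where "X = rec_nat x0 (\<lambda>n x. R n x - a n *\<^sub>R x)"
  have X0: "X 0 = x0" and XSuc: "X (Suc n) = R n (X n) - a n *\<^sub>R X n" for n
    by (simp_all add: X_def)
  have AX: "A (X n) = v n *\<^sub>R X n" for n
    by (induction n) (auto simp: X0 XSuc x0 a v_def)
  have d: "s' - s \<noteq> 0" using ne by simp
  have "finite {k. X (2 * k) \<noteq> 0}"
  proof (rule finite_subset)
    show "{k. X (2 * k) \<noteq> 0} \<subseteq> (\<lambda>k. v (2 * k)) -` eigenvalues A"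
      using AX by (auto simp: eigenvalues_def)
    show "finite ((\<lambda>k. v (2 * k)) -` eigenvalues A)"
      using d by (intro finite_vimageI[OF fin] injI) (simp add: v_def)
  qed
  moreover have "finite {k. X (Suc (2 * k)) \<noteq> 0}"
  proof (rule finite_subset)
    show "{k. X (Suc (2 * k)) \<noteq> 0} \<subseteq> (\<lambda>k. v (Suc (2 * k))) -` eigenvalues A"
      using AX by (auto simp: eigenvalues_def)
    show "finite ((\<lambda>k. v (Suc (2 * k))) -` eigenvalues A)"
      using d by (intro finite_vimageI[OF fin] injI) (simp add: v_def)
  qed
  ultimately have fin': "finite (insert 0 ((\<lambda>k. X (2 * k)) ` {k. X (2 * k) \<noteq> 0} \<union>
      (\<lambda>k. X (Suc (2 * k))) ` {k. X (Suc (2 * k)) \<noteq> 0}))"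
    by simp
  have "X n \<in> insert 0 ((\<lambda>k. X (2 * k)) ` {k. X (2 * k) \<noteq> 0} \<union>
      (\<lambda>k. X (Suc (2 * k))) ` {k. X (Suc (2 * k)) \<noteq> 0})" for n
    by (cases "even n") (auto elim!: evenE oddE)
  then have F: "finite (range X)" by (intro finite_subset[OF _ fin']) (rule image_subsetI)
  let ?S = "complex_vector.span (range X)"
  have X: "r *\<^sub>R X n \<in> ?S" for r n
    by (simp add: scaleR_scaleC complex_vector.span_scale complex_vector.span_base)
  have same: "R n (X n) \<in> ?S" for n
  proof -
    have "R n (X n) = X (Suc n) + a n *\<^sub>R X n" by (simp add: XSuc)
    then show ?thesis using X by (simp add: complex_vector.span_add complex_vector.span_base)
  qed
  have later: "R n (X (Suc n)) \<in> ?S" for n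
  proof -
    have "R n (X (Suc n)) = (1 - a n) *\<^sub>R R n (X n)"
      by (simp add: XSuc linear_diff[OF Rlin] linear_scale[OF Rlin] orthogonal_projection_idem[OF proj] algebra_simps)
    then show ?thesis using same by (simp add: scaleR_scaleC complex_vector.span_scale)
  qed
  have "Q (X n) \<in> ?S \<and> Q' (X n) \<in> ?S" for n
  proof (cases n)
    case 0
    then show ?thesis using same[of 0] X[of b 0] x0 by (simp add: R_def X0)
  next
    case (Suc m)
    then show ?thesis using same[of n] later[of m] by (cases "even m") (auto simp: R_def)
  qed
  then have "eigenvector_system A Q Q' (range X)"
    using F AX by (auto simp: eigenvector_system_def)
  moreover have "x0 \<in> range X" using X0 by (metis rangeI)
  ultimately show ?thesis by blast
qed

text \<open>
  The ray needs a starting vector that is an eigenvector of one of the projections as well, and must not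
  run into a center.  If a center is an eigenvalue, its eigenspace is invariant under the projection, which
  supplies the vector; the ray from there never returns to a center.  Otherwise take an
  eigenvalue with the largest distance to the midpoint of the centers.  One of its two reflections is
  farther away, hence no eigenvalue, so the off-diagonal part of that projection vanishes.
\<close>

lemma distinct_centers_finite:
  assumes A: "symmetric_operator A" and fin: "finite (eigenvalues A)" and nonempty: "eigenvalues A \<noteq> {}"
    and Q: "reflecting_projection A s Q" and Q': "reflecting_projection A s' Q'" and ne: "s \<noteq> s'"
  shows "\<exists>F. eigenvector_system A Q Q' F \<and> (\<exists>x\<in>F. x \<noteq> 0)"
proof -
  note Alin = bounded_linear.linear[OF symmetric_operator_linear[OF A]]
  have at_center: "\<exists>F. eigenvector_system A Q Q' F \<and> (\<exists>x\<in>F. x \<noteq> 0)"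
    if Q: "reflecting_projection A s Q" and Q': "reflecting_projection A s' Q'" and ne: "s \<noteq> s'"
      and s: "s \<in> eigenvalues A" for s s' Q Q'
  proof -
    obtain x where x: "x \<noteq> 0" "A x = s *\<^sub>R x" using s by (auto simp: eigenvalues_def)
    have "orthogonal_projection Q" using Q by (simp add: reflecting_projection_def)
    then obtain x0 b where x0: "x0 \<noteq> 0" "A x0 = s *\<^sub>R x0" "Q x0 = b *\<^sub>R x0"
      using reflecting_projection_fixes_center[OF A Q x(2)] x orthogonal_projection_idem
      by (metis scaleR_one scaleR_zero_left)
    have "s - 2 * (s' - s) * real k \<noteq> s'" for k
    proof
      assume "s - 2 * (s' - s) * real k = s'"
      then have "(s' - s) * (2 * real k + 1) = 0" by (simp add: algebra_simps)
      then show False using ne by simp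
    qed
    moreover have "2 * s' - s + 2 * (s' - s) * real k \<noteq> s" for k
    proof
      assume "2 * s' - s + 2 * (s' - s) * real k = s"
      then have "(s' - s) * (2 * real k + 2) = 0" by (simp add: algebra_simps)
      then show False using ne by simp
    qed
    ultimately have "\<exists>F. eigenvector_system A Q Q' F \<and> x0 \<in> F"
      by (intro reflection_ray[OF Alin fin Q Q' ne x0(2,3)] disjI1)
    then show ?thesis using x0(1) by blast
  qed
  have at_end: "\<exists>F. eigenvector_system A Q Q' F \<and> (\<exists>x\<in>F. x \<noteq> 0)"
    if Q: "reflecting_projection A s Q" and Q': "reflecting_projection A s' Q'" and ne: "s \<noteq> s'"
      and s: "s \<notin> eigenvalues A" "s' \<notin> eigenvalues A"
      and l: "l \<in> eigenvalues A" "2 * s - l \<notin> eigenvalues A" for s s' Q Q' l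
  proof -
    obtain x where x: "x \<noteq> 0" "A x = l *\<^sub>R x" using l by (auto simp: eigenvalues_def)
    obtain a where "A (Q x - a *\<^sub>R x) = (2 * s - l) *\<^sub>R (Q x - a *\<^sub>R x)"
      using reflecting_projection_coefficient[OF Alin Q] s(1) x(2) by blast
    then have "Q x - a *\<^sub>R x = 0" using l(2) unfolding eigenvalues_def by blast
    then have "Q x = a *\<^sub>R x" by simp
    then have "\<exists>F. eigenvector_system A Q Q' F \<and> x \<in> F"
      by (rule reflection_ray[OF Alin fin Q Q' ne x(2)]) (simp_all add: s)
    then show ?thesis using x(1) by blast
  qed
  define m where "m = (s + s') / 2"
  have "Max ((\<lambda>l. \<bar>l - m\<bar>) ` eigenvalues A) \<in> (\<lambda>l. \<bar>l - m\<bar>) ` eigenvalues A"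
    using fin nonempty by (intro Max_in) auto
  then obtain l where l: "l \<in> eigenvalues A" "\<bar>l - m\<bar> = Max ((\<lambda>l. \<bar>l - m\<bar>) ` eigenvalues A)"
    by auto
  have max: "\<bar>l' - m\<bar> \<le> \<bar>l - m\<bar>" if "l' \<in> eigenvalues A" for l'
    unfolding l(2) using fin that by (intro Max_ge) auto
  have "\<bar>l - m\<bar> < \<bar>(2 * s - l) - m\<bar> \<or> \<bar>l - m\<bar> < \<bar>(2 * s' - l) - m\<bar>"
    using ne unfolding m_def by argo
  then have out: "2 * s - l \<notin> eigenvalues A \<or> 2 * s' - l \<notin> eigenvalues A"
    using max by fastforce
  consider "s \<in> eigenvalues A" | "s' \<in> eigenvalues A"
    | "s \<notin> eigenvalues A" "s' \<notin> eigenvalues A" "2 * s - l \<notin> eigenvalues A"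
    | "s \<notin> eigenvalues A" "s' \<notin> eigenvalues A" "2 * s' - l \<notin> eigenvalues A"
    using out by blast
  then show ?thesis
  proof cases
    case 1
    show ?thesis by (rule at_center[OF Q Q' ne 1])
  next
    case 2
    show ?thesis using at_center[OF Q' Q ne[symmetric] 2] eigenvector_system_swap by blast
  next
    case 3
    show ?thesis by (rule at_end[OF Q Q' ne 3(1,2) l(1) 3(3)])
  next
    case 4
    show ?thesis using at_end[OF Q' Q ne[symmetric] 4(2,1) l(1) 4(3)] eigenvector_system_swap by blast
  qed
qed

section \<open>Finite systems of eigenvectors: equal centers\<close>

text \<open>
  If \<open>(A - s)\<^sup>2 = k\<close> with \<open>k > 0\<close>, then only \<open>s + sqrt k\<close> and \<open>s - sqrt k\<close> can be eigenvalues, and the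
  projections onto the two eigenspaces are linear polynomials in \<open>A\<close>.  Otherwise \<open>A = s\<close>, because the quadratic
  form of \<open>(A - s)\<^sup>2\<close> is nonnegative, and \<open>t = 0\<close> serves.
\<close>

lemma eigenvector_decomposition:
  assumes A: "symmetric_operator A" and k: "\<And>x. shifted_square A s x = k *\<^sub>R (x :: 'h::complex_inner)"
  shows "\<exists>t. \<forall>x. \<exists>y z. x = y + z \<and> A y = (s + t) *\<^sub>R y \<and> A z = (s - t) *\<^sub>R z \<and>
    y \<in> complex_vector.span {x, A x} \<and> z \<in> complex_vector.span {x, A x}"
proof (cases "0 < k")
  case True
  note lin = bounded_linear.linear[OF symmetric_operator_linear[OF A]]
  define t where "t = sqrt k"
  have t: "0 < t" "t * t = k" using True by (simp_all add: t_def)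
  have "\<exists>y z. x = y + z \<and> A y = (s + t) *\<^sub>R y \<and> A z = (s - t) *\<^sub>R z \<and>
    y \<in> complex_vector.span {x, A x} \<and> z \<in> complex_vector.span {x, A x}" for x
  proof -
    define v where "v = A x - s *\<^sub>R x"
    have Ax: "A x = v + s *\<^sub>R x" by (simp add: v_def)
    have Av: "A v = (t * t) *\<^sub>R x + s *\<^sub>R v"
      using k[of x] by (simp add: shifted_square_def v_def t algebra_simps)
    have span: "a *\<^sub>R v + b *\<^sub>R x \<in> complex_vector.span {x, A x}" for a b
      unfolding v_def scaleR_scaleC
      by (intro complex_vector.span_add complex_vector.span_scale complex_vector.span_diff)
        (auto intro: complex_vector.span_base)
    have "x = ((1 / (2 * t)) *\<^sub>R v + (1 / 2) *\<^sub>R x) + ((- 1 / (2 * t)) *\<^sub>R v + (1 / 2) *\<^sub>R x)"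
      by (simp flip: scaleR_add_left)
    moreover have "A (v + t *\<^sub>R x) = (s + t) *\<^sub>R (v + t *\<^sub>R x)"
      by (simp add: linear_add[OF lin] linear_scale[OF lin] Ax Av algebra_simps)
    then have "(1 / (2 * t)) *\<^sub>R A (v + t *\<^sub>R x) = (1 / (2 * t)) *\<^sub>R (s + t) *\<^sub>R (v + t *\<^sub>R x)"
      by simp
    then have "A ((1 / (2 * t)) *\<^sub>R v + (1 / 2) *\<^sub>R x) = (s + t) *\<^sub>R ((1 / (2 * t)) *\<^sub>R v + (1 / 2) *\<^sub>R x)"
      using t(1) by (simp add: linear_add[OF lin] linear_scale[OF lin] scaleR_add_right mult.commute)
    moreover have "A (v - t *\<^sub>R x) = (s - t) *\<^sub>R (v - t *\<^sub>R x)"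
      by (simp add: linear_diff[OF lin] linear_scale[OF lin] Ax Av algebra_simps)
    then have "(- 1 / (2 * t)) *\<^sub>R A (v - t *\<^sub>R x) = (- 1 / (2 * t)) *\<^sub>R (s - t) *\<^sub>R (v - t *\<^sub>R x)"
      by simp
    then have "A ((- 1 / (2 * t)) *\<^sub>R v + (1 / 2) *\<^sub>R x) = (s - t) *\<^sub>R ((- 1 / (2 * t)) *\<^sub>R v + (1 / 2) *\<^sub>R x)"
      using t(1) by (simp add: linear_add[OF lin] linear_diff[OF lin] linear_scale[OF lin] scaleR_diff_right
          scaleR_add_right linear_neg[OF lin] mult.commute)
    ultimately show ?thesis using span by blast
  qed
  then show ?thesis by blast
next
  case False
  have "symmetric_operator (\<lambda>x. A x - s *\<^sub>R x)"
    by (rule symmetric_operator_diff[OF A symmetric_operator_scaleR[OF symmetric_operator_id]])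
  from symmetric_operator_inner[OF this]
  have "inner (A x - s *\<^sub>R x) (A x - s *\<^sub>R x) = inner (shifted_square A s x) x" for x
    by (metis shifted_square_def)
  then have "inner (A x - s *\<^sub>R x) (A x - s *\<^sub>R x) \<le> 0" for x
    using False by (simp add: k mult_nonpos_nonneg)
  then have "inner (A x - s *\<^sub>R x) (A x - s *\<^sub>R x) = 0" for x
    using inner_ge_zero order_antisym by blast
  then have eig: "A x = s *\<^sub>R x" for x by simp
  have "\<exists>y z. x = y + z \<and> A y = (s + 0) *\<^sub>R y \<and> A z = (s - 0) *\<^sub>R z \<and>
    y \<in> complex_vector.span {x, A x} \<and> z \<in> complex_vector.span {x, A x}" for x
    by (intro exI[of _ x] exI[of _ 0]) (simp add: eig complex_vector.span_zero complex_vector.span_base)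
  then show ?thesis by blast
qed

text \<open>
  Let \<open>a\<close> and \<open>c\<close> be the diagonal scalars of \<open>Q\<close> on the two eigenspaces of \<open>A\<close>.  A linear polynomial in \<open>A\<close> removes
  them and leaves the part \<open>K\<close> that exchanges the eigenspaces.  The components of the equation \<open>Q\<^sup>2 = Q\<close> say
  that \<open>K\<^sup>2\<close> is \<open>a (1 - a)\<close> and \<open>c (1 - c)\<close> on the two eigenspaces, and that \<open>(1 - a - c) K = 0\<close>; so either
  these scalars agree or \<open>K = 0\<close>.  When \<open>A = s\<close>, the operator \<open>Q - 1/2\<close> serves the same purpose.
\<close>

lemma off_diagonal_part:
  assumes A: "symmetric_operator A" and k: "\<And>x. shifted_square A s x = k *\<^sub>R (x :: 'h::complex_inner)"
    and Q: "reflecting_projection A s Q"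
  shows "\<exists>b e r. \<forall>x. let K = (\<lambda>x. Q x + b *\<^sub>R A x + e *\<^sub>R x) in
    K (K x) = r *\<^sub>R x \<and> A (K x) = (2 * s) *\<^sub>R K x - K (A x)"
proof -
  have proj: "orthogonal_projection Q" using Q by (simp add: reflecting_projection_def)
  note Alin = bounded_linear.linear[OF symmetric_operator_linear[OF A]]
  note Qlin = bounded_linear.linear[OF orthogonal_projection_bounded_linear[OF proj]]
  obtain t where t: "\<And>x. \<exists>y z. x = y + z \<and> A y = (s + t) *\<^sub>R y \<and> A z = (s - t) *\<^sub>R z \<and>
    y \<in> complex_vector.span {x, A x} \<and> z \<in> complex_vector.span {x, A x}"
    using eigenvector_decomposition[OF A k] by blast
  show ?thesis
  proof (cases "t = 0")
    case True
    have eig: "A x = s *\<^sub>R x" for x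
      using t[of x] True by (auto simp: linear_add[OF Alin] scaleR_add_right)
    have half: "(1 / 2) *\<^sub>R y + (1 / 2) *\<^sub>R y = y" for y :: 'h
      by (simp flip: scaleR_add_left)
    define K where "K = (\<lambda>x. Q x + 0 *\<^sub>R A x + (- (1 / 2)) *\<^sub>R x)"
    have "K (K x) = Q x - ((1 / 2) *\<^sub>R Q x + (1 / 2) *\<^sub>R Q x) + (1 / 4) *\<^sub>R x" for x
      by (simp add: K_def linear_diff[OF Qlin] linear_scale[OF Qlin] orthogonal_projection_idem[OF proj]
          scaleR_diff_right)
    then have "K (K x) = (1 / 4) *\<^sub>R x" for x by (simp only: half) simp
    moreover have "A (K x) = (2 * s) *\<^sub>R K x - K (A x)" for x
    proof -
      have "(2 * s) *\<^sub>R K x - K (A x) = (2 * s - s) *\<^sub>R K x"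
        unfolding eig scaleR_diff_left by (simp add: K_def linear_scale[OF Qlin] scaleR_diff_right mult.commute)
      then show ?thesis by (simp add: eig)
    qed
    ultimately show ?thesis unfolding K_def Let_def by blast
  next
    case False
    obtain a where a: "\<And>x. A x = (s + t) *\<^sub>R x \<Longrightarrow> A (Q x - a *\<^sub>R x) = (s - t) *\<^sub>R (Q x - a *\<^sub>R x)"
      using reflecting_projection_coefficient[OF Alin Q, of "s + t"] False by (auto simp: algebra_simps)
    obtain c where c: "\<And>x. A x = (s - t) *\<^sub>R x \<Longrightarrow> A (Q x - c *\<^sub>R x) = (s + t) *\<^sub>R (Q x - c *\<^sub>R x)"
      using reflecting_projection_coefficient[OF Alin Q, of "s - t"] False by (auto simp: algebra_simps)
    define b where "b = (c - a) / (2 * t)"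
    define e where "e = - (a + c) / 2 - b * s"
    define K where "K = (\<lambda>x. Q x + b *\<^sub>R A x + e *\<^sub>R x)"
    have ab: "b * (s + t) + e = - a" "b * (s - t) + e = - c"
      using False by (simp_all add: b_def e_def field_simps)
    have Kadd: "K (x + y) = K x + K y" and Kscale: "K (r *\<^sub>R x) = r *\<^sub>R K x" for x y r
      by (simp_all add: K_def linear_add[OF Qlin] linear_add[OF Alin] linear_scale[OF Qlin] linear_scale[OF Alin]
          algebra_simps)
    have Kp: "K x = Q x - a *\<^sub>R x" if "A x = (s + t) *\<^sub>R x" for x
      using ab(1) by (simp add: K_def that add.assoc flip: scaleR_add_left)
    have Km: "K x = Q x - c *\<^sub>R x" if "A x = (s - t) *\<^sub>R x" for x
      using ab(2) by (simp add: K_def that add.assoc flip: scaleR_add_left)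
    have AKp: "A (K x) = (s - t) *\<^sub>R K x" if "A x = (s + t) *\<^sub>R x" for x
      using a[OF that] by (simp add: Kp[OF that])
    have AKm: "A (K x) = (s + t) *\<^sub>R K x" if "A x = (s - t) *\<^sub>R x" for x
      using c[OF that] by (simp add: Km[OF that])
    have both: "x = 0" if "A x = (s + t) *\<^sub>R x" "A x = (s - t) *\<^sub>R x" for x
    proof -
      have "(2 * t) *\<^sub>R x = (s + t) *\<^sub>R x - (s - t) *\<^sub>R x" by (simp flip: scaleR_diff_left)
      also have "\<dots> = 0" using that by simp
      finally show ?thesis using False by simp
    qed
    have KKp: "K (K x) = (a * (1 - a)) *\<^sub>R x \<and> (1 - a - c) *\<^sub>R K x = 0" if x: "A x = (s + t) *\<^sub>R x" for x
    proof -
      have KK: "K (K x) = (1 - a - c) *\<^sub>R K x + (a * (1 - a)) *\<^sub>R x"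
        by (simp add: Km[OF AKp[OF x]]) (simp add: Kp[OF x] linear_diff[OF Qlin] linear_scale[OF Qlin]
            orthogonal_projection_idem[OF proj] algebra_simps)
      have "A (K (K x) - (a * (1 - a)) *\<^sub>R x) = (s + t) *\<^sub>R (K (K x) - (a * (1 - a)) *\<^sub>R x)"
        using AKm[OF AKp[OF x]] x
        by (simp add: linear_diff[OF Alin] linear_scale[OF Alin] scaleR_diff_right mult.commute)
      moreover have "K (K x) - (a * (1 - a)) *\<^sub>R x = (1 - a - c) *\<^sub>R K x" using KK by simp
      ultimately have "A ((1 - a - c) *\<^sub>R K x) = (s + t) *\<^sub>R ((1 - a - c) *\<^sub>R K x)" by simp
      moreover have "A ((1 - a - c) *\<^sub>R K x) = (s - t) *\<^sub>R ((1 - a - c) *\<^sub>R K x)"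
        by (simp add: linear_scale[OF Alin] AKp[OF x])
      ultimately have "(1 - a - c) *\<^sub>R K x = 0" by (rule both)
      then show ?thesis using KK by simp
    qed
    have KKm: "K (K x) = (c * (1 - c)) *\<^sub>R x \<and> (1 - a - c) *\<^sub>R K x = 0" if x: "A x = (s - t) *\<^sub>R x" for x
    proof -
      have KK: "K (K x) = (1 - a - c) *\<^sub>R K x + (c * (1 - c)) *\<^sub>R x"
        by (simp add: Kp[OF AKm[OF x]]) (simp add: Km[OF x] linear_diff[OF Qlin] linear_scale[OF Qlin]
            orthogonal_projection_idem[OF proj] algebra_simps)
      have "A (K (K x) - (c * (1 - c)) *\<^sub>R x) = (s - t) *\<^sub>R (K (K x) - (c * (1 - c)) *\<^sub>R x)"
        using AKp[OF AKm[OF x]] x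
        by (simp add: linear_diff[OF Alin] linear_scale[OF Alin] scaleR_diff_right mult.commute)
      moreover have "K (K x) - (c * (1 - c)) *\<^sub>R x = (1 - a - c) *\<^sub>R K x" using KK by simp
      ultimately have "A ((1 - a - c) *\<^sub>R K x) = (s - t) *\<^sub>R ((1 - a - c) *\<^sub>R K x)" by simp
      moreover have "A ((1 - a - c) *\<^sub>R K x) = (s + t) *\<^sub>R ((1 - a - c) *\<^sub>R K x)"
        by (simp add: linear_scale[OF Alin] AKm[OF x])
      ultimately have "(1 - a - c) *\<^sub>R K x = 0" using both by blast
      then show ?thesis using KK by simp
    qed
    obtain r where r: "\<And>x. A x = (s + t) *\<^sub>R x \<Longrightarrow> K (K x) = r *\<^sub>R x"
      "\<And>x. A x = (s - t) *\<^sub>R x \<Longrightarrow> K (K x) = r *\<^sub>R x"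
    proof (cases "1 - a - c = 0")
      case True
      then have "c = 1 - a" by simp
      then have "c * (1 - c) = a * (1 - a)" by simp
      then show ?thesis using that[of "a * (1 - a)"] KKp KKm by metis
    next
      case False
      have K0: "K 0 = 0" using Kscale[of 0 0] by simp
      have "K (K x) = 0 *\<^sub>R x" if "A x = (s + t) *\<^sub>R x" for x using KKp[OF that] False K0 by simp
      moreover have "K (K x) = 0 *\<^sub>R x" if "A x = (s - t) *\<^sub>R x" for x using KKm[OF that] False K0 by simp
      ultimately show ?thesis by (rule that)
    qed
    have "K (K x) = r *\<^sub>R x \<and> A (K x) = (2 * s) *\<^sub>R K x - K (A x)" for x
    proof -
      obtain y z where x: "x = y + z" and y: "A y = (s + t) *\<^sub>R y" and z: "A z = (s - t) *\<^sub>R z"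
        using t[of x] by blast
      have "K (K x) = r *\<^sub>R x" by (simp add: x Kadd r y z scaleR_add_right)
      moreover have "A (K x) = (2 * s) *\<^sub>R K x - K (A x)"
        by (simp add: x Kadd linear_add[OF Alin] AKp[OF y] AKm[OF z] y z Kscale)
          (simp add: algebra_simps flip: scaleR_2)
      ultimately show ?thesis by simp
    qed
    then show ?thesis unfolding K_def Let_def by blast
  qed
qed

text \<open>
  The operator \<open>G = K K' + K' K\<close> commutes with \<open>K\<close>, \<open>K'\<close> (their squares are scalars) and with \<open>A\<close>, hence with
  \<open>Q\<close> and \<open>Q'\<close>, so it is a scalar.  With \<open>K\<^sup>2\<close>, \<open>K'\<^sup>2\<close> and \<open>G\<close> scalar, every word in \<open>K\<close> and \<open>K'\<close>
  reduces to a combination of \<open>1\<close>, \<open>K\<close>, \<open>K'\<close> and \<open>K K'\<close>.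
\<close>

lemma equal_centers_finite:
  fixes A :: "'h::chilbert_space \<Rightarrow> 'h"
  assumes A: "symmetric_operator A" and Ac: "\<And>c x. A (c *\<^sub>C x) = c *\<^sub>C A x"
    and k: "\<And>x. shifted_square A s x = k *\<^sub>R x"
    and Q: "reflecting_projection A s Q" and Q': "reflecting_projection A s Q'"
    and irr: "irreducible_family {A, Q, Q'} (\<lambda>R. R)"
    and x: "A x = l *\<^sub>R x"
  shows "\<exists>F. eigenvector_system A Q Q' F \<and> x \<in> F"
proof -
  have proj: "orthogonal_projection Q" and proj': "orthogonal_projection Q'"
    using Q Q' by (simp_all add: reflecting_projection_def)
  note sym = orthogonal_projection_symmetric[OF proj] orthogonal_projection_symmetric[OF proj'] A
  note Alin = bounded_linear.linear[OF symmetric_operator_linear[OF A]]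
  obtain b e r where ber: "\<forall>x. let K = (\<lambda>x. Q x + b *\<^sub>R A x + e *\<^sub>R x) in
      K (K x) = r *\<^sub>R x \<and> A (K x) = (2 * s) *\<^sub>R K x - K (A x)"
    using off_diagonal_part[OF A k Q] by blast
  obtain b' e' r' where ber': "\<forall>x. let K = (\<lambda>x. Q' x + b' *\<^sub>R A x + e' *\<^sub>R x) in
      K (K x) = r' *\<^sub>R x \<and> A (K x) = (2 * s) *\<^sub>R K x - K (A x)"
    using off_diagonal_part[OF A k Q'] by blast
  define K where "K = (\<lambda>x. Q x + b *\<^sub>R A x + e *\<^sub>R x)"
  define K' where "K' = (\<lambda>x. Q' x + b' *\<^sub>R A x + e' *\<^sub>R x)"
  have "\<forall>x. K (K x) = r *\<^sub>R x \<and> A (K x) = (2 * s) *\<^sub>R K x - K (A x)"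
    using ber unfolding Let_def K_def .
  then have KK: "K (K x) = r *\<^sub>R x" and AK: "A (K x) = (2 * s) *\<^sub>R K x - K (A x)" for x
    by blast+
  have "\<forall>x. K' (K' x) = r' *\<^sub>R x \<and> A (K' x) = (2 * s) *\<^sub>R K' x - K' (A x)"
    using ber' unfolding Let_def K'_def .
  then have KK': "K' (K' x) = r' *\<^sub>R x" and AK': "A (K' x) = (2 * s) *\<^sub>R K' x - K' (A x)" for x
    by blast+
  have symK: "symmetric_operator K" unfolding K_def
    by (rule symmetric_operator_add[OF symmetric_operator_add[OF sym(1) symmetric_operator_scaleR[OF A]]
        symmetric_operator_scaleR[OF symmetric_operator_id]])
  have symK': "symmetric_operator K'" unfolding K'_def
    by (rule symmetric_operator_add[OF symmetric_operator_add[OF sym(2) symmetric_operator_scaleR[OF A]]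
        symmetric_operator_scaleR[OF symmetric_operator_id]])
  note Klin = bounded_linear.linear[OF symmetric_operator_linear[OF symK]]
  note Klin' = bounded_linear.linear[OF symmetric_operator_linear[OF symK']]
  note lins = linear_add[OF Klin] linear_diff[OF Klin] linear_scale[OF Klin]
    linear_add[OF Klin'] linear_diff[OF Klin'] linear_scale[OF Klin']
    linear_add[OF Alin] linear_diff[OF Alin] linear_scale[OF Alin]
  have Kc: "K (c *\<^sub>C x) = c *\<^sub>C K x" and Kc': "K' (c *\<^sub>C x) = c *\<^sub>C K' x" for c x
    by (simp_all add: K_def K'_def Ac orthogonal_projection_scaleC proj proj' scaleR_scaleC
        scaleC_add_right scaleC_scaleC mult.commute)
  define G where "G = (\<lambda>x. K (K' x) + K' (K x))"
  have GA: "A (G x) = G (A x)" for x by (simp add: G_def lins AK AK')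
  have GK: "K (G x) = G (K x)" for x by (simp add: G_def lins KK)
  have GK': "K' (G x) = G (K' x)" for x by (simp add: G_def lins KK')
  have Glin: "bounded_linear G" unfolding G_def
    using symK symK' symmetric_operator_linear bounded_linear_compose bounded_linear_add by blast
  have "symmetric_operator G"
    using Glin by (simp add: symmetric_operator_def)
      (simp add: G_def inner_add_left inner_add_right symmetric_operator_inner[OF symK] symmetric_operator_inner[OF symK'])
  moreover have "G (c *\<^sub>C x) = c *\<^sub>C G x" for c x
    by (simp add: G_def Kc Kc' scaleC_add_right)
  moreover have "Q (G x) = G (Q x)" for x
  proof -
    have q: "Q x = K x - b *\<^sub>R A x - e *\<^sub>R x" for x by (simp add: K_def)
    show ?thesis
      unfolding q using bounded_linear.linear[OF Glin] by (simp add: linear_diff linear_scale GA GK)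
  qed
  moreover have "Q' (G x) = G (Q' x)" for x
  proof -
    have q: "Q' x = K' x - b' *\<^sub>R A x - e' *\<^sub>R x" for x by (simp add: K'_def)
    show ?thesis
      unfolding q using bounded_linear.linear[OF Glin] by (simp add: linear_diff linear_scale GA GK')
  qed
  moreover have "bounded_linear R" if "R \<in> {A, Q, Q'}" for R
    using that sym symmetric_operator_linear by blast
  ultimately have "\<exists>g. \<forall>x. G x = g *\<^sub>R x"
    using GA by (intro schur[OF irr]) auto
  then obtain g where g: "\<And>x. K (K' x) + K' (K x) = g *\<^sub>R x" unfolding G_def by blast
  define F where "F = {x, K x, K' x, K (K' x)}"
  let ?S = "complex_vector.span F"
  have in_span: "u *\<^sub>R y \<in> ?S" if "y \<in> F" for u y
    using that by (simp add: scaleR_scaleC complex_vector.span_scale complex_vector.span_base)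
  have diff: "u *\<^sub>R y - u' *\<^sub>R y' \<in> ?S" if "y \<in> F" "y' \<in> F" for u y u' y'
    using that by (simp add: in_span complex_vector.span_diff)
  have KF: "K y \<in> ?S" if "y \<in> F" for y
    using that in_span[of x] in_span[of "K' x" r] in_span[of "K x" 1] in_span[of "K (K' x)" 1] KK
    by (auto simp: F_def)
  have sw: "K' (K x) = g *\<^sub>R x - 1 *\<^sub>R K (K' x)" for x using g[of x] by (simp add: algebra_simps)
  have KF': "K' y \<in> ?S" if "y \<in> F" for y
  proof -
    have "K' (K (K' x)) = g *\<^sub>R K' x - r' *\<^sub>R K x" by (simp add: sw KK' lins)
    then show ?thesis
      using that diff[of x "K (K' x)" g 1] diff[of "K' x" "K x" g r'] in_span[of "K' x" 1] in_span[of x r'] sw[of x] KK'[of x]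
      by (auto simp: F_def)
  qed
  have eig: "\<exists>l. A y = l *\<^sub>R y" if "y \<in> F" for y
  proof -
    have "A (K x) = (2 * s - l) *\<^sub>R K x" "A (K' x) = (2 * s - l) *\<^sub>R K' x"
      by (simp_all add: AK AK' x lins algebra_simps)
    moreover have "A (K (K' x)) = l *\<^sub>R K (K' x)"
      unfolding AK[of "K' x"] calculation(2) by (simp add: lins algebra_simps)
    ultimately show ?thesis using that x by (auto simp: F_def)
  qed
  have "Q y \<in> ?S \<and> Q' y \<in> ?S" if y: "y \<in> F" for y
  proof -
    obtain l where l: "A y = l *\<^sub>R y" using eig[OF y] by blast
    have "Q y = K y - (b * l + e) *\<^sub>R y" "Q' y = K' y - (b' * l + e') *\<^sub>R y"
      by (simp_all add: K_def K'_def l algebra_simps)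
    then show ?thesis using in_span[OF y] KF[OF y] KF'[OF y] by (simp add: complex_vector.span_diff)
  qed
  then have "eigenvector_system A Q Q' F"
    using eig by (simp add: eigenvector_system_def) (simp add: F_def)
  then show ?thesis by (intro exI[of _ F]) (simp add: F_def)
qed

section \<open>Finite dimensionality\<close>

theorem theorem2:
  fixes S S\<^sub>1 S\<^sub>2 :: "'a::order set"
    and \<alpha> :: "'a \<Rightarrow> real"
    and P :: "'a \<Rightarrow> 'h::chilbert_space \<Rightarrow> 'h"
  assumes "finite S"
    and "S = S\<^sub>1 \<union> S\<^sub>2"
    and "unitarily_one_parameter S\<^sub>1"
    and "unitarily_one_parameter S\<^sub>2"
    and "\<And>g. g \<in> S \<Longrightarrow> 0 < \<alpha> g \<and> \<alpha> g < 1"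
    and "(\<Sum>g\<in>S. \<alpha> g) > 1"
    and "hilbert_representation S P"
    and "irreducible_family S P"
    and "orthoscalar S \<alpha> P"
  shows "\<exists>B :: 'h set. finite B \<and> complex_vector.span B = UNIV"
proof -
  note irr = assms(8)
  have proj: "\<And>g. g \<in> S \<Longrightarrow> orthogonal_projection (P g)"
    and mono: "\<And>g h. g \<in> S \<Longrightarrow> h \<in> S \<Longrightarrow> g < h \<Longrightarrow> P g \<circ> P h = P g"
    and "(UNIV :: 'h set) \<noteq> {0}"
    using assms(7) by (auto simp: hilbert_representation_def)
  then obtain z :: 'h where z: "z \<noteq> 0" by auto
  note bl = orthogonal_projection_bounded_linear[OF proj]
  note pc = orthogonal_projection_scaleC[OF proj]
  obtain p1 q1 where pq1: "p1 \<in> S\<^sub>1" "q1 \<in> S\<^sub>1" "\<not> p1 \<le> q1" "\<not> q1 \<le> p1"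
    "\<And>g h. g \<in> S\<^sub>1 - {p1, q1} \<Longrightarrow> h \<in> S\<^sub>1 \<Longrightarrow> g \<le> h \<or> h \<le> g"
    using unitarily_one_parameter_pair[OF assms(3)] by blast
  obtain p2 q2 where pq2: "p2 \<in> S\<^sub>2" "q2 \<in> S\<^sub>2" "\<not> p2 \<le> q2" "\<not> q2 \<le> p2"
    "\<And>g h. g \<in> S\<^sub>2 - {p2, q2} \<Longrightarrow> h \<in> S\<^sub>2 \<Longrightarrow> g \<le> h \<or> h \<le> g"
    using unitarily_one_parameter_pair[OF assms(4)] by blast
  \<comment> \<open>common elements are shared equally, so that the weights are positive on both parts\<close>
  define w where "w = (\<lambda>g. if g \<in> S\<^sub>1 \<inter> S\<^sub>2 then \<alpha> g / 2 else \<alpha> g)"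
  have wpos: "0 < w g" if "g \<in> S" for g using assms(5)[OF that] by (simp add: w_def)
  interpret r1: one_parameter_representation S\<^sub>1 P w p1 q1
    using assms(1,2) proj mono wpos pq1 by unfold_locales auto
  interpret r2: one_parameter_representation S\<^sub>2 P w p2 q2
    using assms(1,2) proj mono wpos pq2 by unfold_locales auto
  define A where "A = r1.A"
  have sum: "r1.A x + r2.A x = x" for x
  proof -
    have fin: "finite S\<^sub>1" "finite S\<^sub>2" using assms(1,2) by auto
    have "r1.A x + r2.A x = (\<Sum>g\<in>S. w g *\<^sub>R P g x) + (\<Sum>g\<in>S\<^sub>1 \<inter> S\<^sub>2. w g *\<^sub>R P g x)"
      using sum.union_inter[OF fin, of "\<lambda>g. w g *\<^sub>R P g x"] by (simp add: r1.A_def r2.A_def assms(2))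
    also have "(\<Sum>g\<in>S\<^sub>1 \<inter> S\<^sub>2. w g *\<^sub>R P g x) = (\<Sum>g\<in>S. if g \<in> S\<^sub>1 \<inter> S\<^sub>2 then w g *\<^sub>R P g x else 0)"
      using assms(1,2) by (subst sum.inter_restrict[symmetric]) (auto intro: sum.cong)
    also have "(\<Sum>g\<in>S. w g *\<^sub>R P g x) + \<dots> = (\<Sum>g\<in>S. \<alpha> g *\<^sub>R P g x)"
      unfolding sum.distrib[symmetric] by (intro sum.cong) (auto simp: w_def simp flip: scaleR_add_left)
    also have "\<dots> = x" using assms(9) by (simp add: orthoscalar_def)
    finally show ?thesis .
  qed
  have B: "r2.A x = x - A x" for x using sum[of x] by (simp add: A_def algebra_simps)
  have symA: "symmetric_operator A" and Ac: "A (c *\<^sub>C x) = c *\<^sub>C A x" for c x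
    by (simp_all add: A_def r1.symmetric_A r1.A_scaleC)
  note linA = bounded_linear.linear[OF symmetric_operator_linear[OF symA]]
  have "r2.A = (\<lambda>x. x - A x)" using B by (rule ext)
  then have eff: "effect A"
    using r1.positive_A r2.positive_A by (simp add: effect_def A_def)
  define s where "s = r1.center"
  define s' where "s' = 1 - r2.center"
  have Q1: "reflecting_projection A s (P p1)"
    unfolding A_def s_def by (rule r1.reflecting_projection_A)
  have Q2: "reflecting_projection A s' (P p2)"
    unfolding s'_def by (rule reflecting_projection_complement[OF linA B r2.reflecting_projection_A])
  have comm: "(\<forall>x. P g (shifted_square A s x) = shifted_square A s (P g x)) \<or>
      (\<forall>x. P g (shifted_square A s' x) = shifted_square A s' (P g x))" if "g \<in> S" for g
    using that r1.shifted_square_commute[of g] r2.shifted_square_commute[of g] assms(2)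
    by (auto simp: s_def A_def[symmetric] s'_def shifted_square_complement[OF linA B])
  have determined: "P g x \<in> complex_vector.span {x, P p1 x, P p2 x}" if "g \<in> S" "A x = l *\<^sub>R x" for g x l
  proof (cases "g \<in> S\<^sub>1")
    case True
    then show ?thesis
      using r1.eigenvector_span[of x l g] that(2) complex_vector.span_mono[of "{x, P p1 x}" "{x, P p1 x, P p2 x}"]
      by (auto simp: A_def)
  next
    case False
    moreover have "r2.A x = (1 - l) *\<^sub>R x" by (simp add: B that(2) algebra_simps)
    ultimately show ?thesis
      using r2.eigenvector_span[of x "1 - l" g] that(1) assms(2)
        complex_vector.span_mono[of "{x, P p2 x}" "{x, P p1 x, P p2 x}"]
      by auto
  qed
  have "\<exists>F. eigenvector_system A (P p1) (P p2) F \<and> (\<exists>x\<in>F. x \<noteq> 0)"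
  proof (cases "s = s'")
    case False
    have "finite (eigenvalues A) \<and> eigenvalues A \<noteq> {}"
      by (rule two_centers_finite_eigenvalues[OF irr bl eff Ac False comm z])
    then show ?thesis using distinct_centers_finite[OF symA _ _ Q1 Q2 False] by blast
  next
    case True
    have "bounded_linear (\<lambda>x. A x - s *\<^sub>R x)" "symmetric_operator (\<lambda>x. A x - s *\<^sub>R x)"
      using symA symmetric_operator_diff[OF symA symmetric_operator_scaleR[OF symmetric_operator_id]]
        symmetric_operator_linear by auto
    then have "symmetric_operator (shifted_square A s)"
      using symmetric_operator_comp[of "\<lambda>x. A x - s *\<^sub>R x" "\<lambda>x. A x - s *\<^sub>R x"]
      by (simp add: shifted_square_def[abs_def])
    moreover have "shifted_square A s (c *\<^sub>C x) = c *\<^sub>C shifted_square A s x" for c x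
      by (simp add: shifted_square_def Ac scaleR_scaleC complex_vector.scale_right_diff_distrib
          linear_diff[OF linA] scaleC_scaleC mult.commute)
    ultimately obtain k where k: "\<And>x. shifted_square A s x = k *\<^sub>R x"
      using schur[OF irr bl, of "shifted_square A s"] comm True by auto
    obtain t where t: "\<And>x. \<exists>y z. x = y + z \<and> A y = (s + t) *\<^sub>R y \<and> A z = (s - t) *\<^sub>R z \<and>
        y \<in> complex_vector.span {x, A x} \<and> z \<in> complex_vector.span {x, A x}"
      using eigenvector_decomposition[OF symA k] by blast
    \<comment> \<open>the eigenvector components of a vector stay in the span of \<open>x\<close> and \<open>A x\<close>, so the three operators determine all \<open>P g\<close>\<close>
    have "irreducible_family {A, P p1, P p2} (\<lambda>R. R)"
      unfolding irreducible_family_def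
    proof (intro allI impI, elim conjE)
      fix M :: "'h set" assume M: "complex_vector.subspace M" "closed M" and inv: "\<forall>R\<in>{A, P p1, P p2}. R ` M \<subseteq> M"
      have eig: "P g y \<in> M" if "g \<in> S" "y \<in> M" "A y = l *\<^sub>R y" for g y l
      proof -
        have "complex_vector.span {y, P p1 y, P p2 y} \<subseteq> M"
          using inv that(2) by (intro complex_vector.span_minimal M) auto
        then show ?thesis using determined[OF that(1,3)] by blast
      qed
      have "P g x \<in> M" if g: "g \<in> S" and x: "x \<in> M" for g x
      proof -
        have "complex_vector.span {x, A x} \<subseteq> M"
          using inv x by (intro complex_vector.span_minimal M) auto
        then obtain y z where "x = y + z" "y \<in> M" "z \<in> M" "A y = (s + t) *\<^sub>R y" "A z = (s - t) *\<^sub>R z"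
          using t[of x] by blast
        then show ?thesis
          using eig[OF g, of y "s + t"] eig[OF g, of z "s - t"] complex_vector.subspace_add[OF M(1)]
            linear_add[OF bounded_linear.linear[OF bl[OF g]]] by simp
      qed
      then show "M = {0} \<or> M = UNIV"
        using irr M unfolding irreducible_family_def by blast
    qed
    note fin = equal_centers_finite[OF symA Ac k Q1 _ this]
    obtain y u where "z = y + u" "A y = (s + t) *\<^sub>R y" "A u = (s - t) *\<^sub>R u" using t[of z] by blast
    then obtain x l where "x \<noteq> 0" "A x = l *\<^sub>R x" using z by (metis add_0)
    then show ?thesis using fin[of x l] Q2 True by blast
  qed
  then obtain F x where F: "eigenvector_system A (P p1) (P p2) F" and x: "x \<in> F" "x \<noteq> 0" by blast
  have "complex_vector.span F = UNIV"
  proof (rule irreducible_finite_span[OF irr bl pc _ x])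
    show "finite F" using F by (simp add: eigenvector_system_def)
    fix g y assume g: "g \<in> S" and y: "y \<in> F"
    then obtain l where "A y = l *\<^sub>R y" using F by (auto simp: eigenvector_system_def)
    from determined[OF g this] show "P g y \<in> complex_vector.span F"
      using F y complex_vector.span_minimal[of "{y, P p1 y, P p2 y}" "complex_vector.span F"]
        complex_vector.span_base[OF y]
      by (auto simp: eigenvector_system_def)
  qed
  then show ?thesis using F by (auto simp: eigenvector_system_def)
qed

end
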